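(* Let $k\ge 2$, $s\ge 2$ and $1\le r\le k-1$ be integers. Let $c$ be a constant satisfying $c>1$ if $s=2$, and $c>k$ if $s\ge 3$. Then \[ \mathbf{RT}_s\big(n,K_{ks+r},c\,\mathbf{f}_{s,s+1}(n/k)\big)\ge \frac12\Big(1-\frac1k\Big)n^2+o(n^2). \] Furthermore, if $r=1$, then \[ \mathbf{RT}_s\big(n,K_{ks+1},c\,\mathbf{f}_{s,s+1}(n/k)\big)=\frac12\Big(1-\frac1k\Big)n^2+o(n^2). \]
   Context: For a graph $G$ and integer $s\ge 2$, the $s$-independence number $\alpha_s(G)$ is the maximum number of vertices of an induced subgraph of $G$ containing no copy of $K_s$. For a graph $H$ and a function $f=f(n)$, $\mathbf{RT}_s(n,H,f)$ is the maximum number of edges of an $H$-free graph on $n$ vertices with $\alpha_s(G)<f$ (or $0$ if no such graph exists). The Erdős–Rogers number $\mathbf{f}_{s,t}(m)$ is the minimum of $\alpha_s(G)$ over all $K_t$-free graphs $G$ on $m$ vertices. Asymptotics as $n\to\infty$; rounding is ignored. *)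

theory Defs
  imports Complex_Main "HOL-Library.Ramsey" "HOL-Library.Landau_Symbols"
begin

(* A pair (V, E) of vertices and edges; edges are two-element sets of vertices. *)
type_synonym 'a sgraph = "'a set \<times> 'a set set"

abbreviation verts :: "'a sgraph \<Rightarrow> 'a set" where
  "verts G \<equiv> fst G"

abbreviation edges :: "'a sgraph \<Rightarrow> 'a set set" where
  "edges G \<equiv> snd G"

definition fin_simple_graph :: "'a sgraph \<Rightarrow> bool" where
  "fin_simple_graph G \<longleftrightarrow> finite (verts G) \<and> edges G \<subseteq> nsets (verts G) 2"

definition complete_graph :: "nat \<Rightarrow> nat sgraph" where
  "complete_graph t = ({..<t}, nsets {..<t} 2)"

definition induced_subgraph :: "'a sgraph \<Rightarrow> 'a set \<Rightarrow> 'a sgraph" where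
  "induced_subgraph G S = (S, {e \<in> edges G. e \<subseteq> S})"

(* Copies of H are not required to be induced. *)
definition contains_copy :: "'a sgraph \<Rightarrow> 'b sgraph \<Rightarrow> bool" where
  "contains_copy G H \<longleftrightarrow>
     (\<exists>\<phi>. inj_on \<phi> (verts H) \<and> \<phi> ` verts H \<subseteq> verts G \<and> (\<forall>e\<in>edges H. \<phi> ` e \<in> edges G))"

abbreviation free_of :: "'a sgraph \<Rightarrow> 'b sgraph \<Rightarrow> bool" where
  "free_of G H \<equiv> \<not> contains_copy G H"

definition indep_num :: "nat \<Rightarrow> 'a sgraph \<Rightarrow> nat" where
  "indep_num s G =
     Max {card S |S. S \<subseteq> verts G \<and> free_of (induced_subgraph G S) (complete_graph s)}"

(* Vertices are natural numbers; up to isomorphism these are all the finite graphs. *)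
definition RT_graphs :: "nat \<Rightarrow> nat \<Rightarrow> 'b sgraph \<Rightarrow> real \<Rightarrow> nat sgraph set" where
  "RT_graphs s n H x =
     {G. fin_simple_graph G \<and> card (verts G) = n \<and> free_of G H \<and> real (indep_num s G) < x}"

(* The last argument is the value f(n) of the bounding function, not the function itself. *)
definition RT :: "nat \<Rightarrow> nat \<Rightarrow> 'b sgraph \<Rightarrow> real \<Rightarrow> nat" where
  "RT s n H x =
     (if RT_graphs s n H x = {} then 0 else Max ((\<lambda>G. card (edges G)) ` RT_graphs s n H x))"

definition erdos_rogers :: "nat \<Rightarrow> nat \<Rightarrow> nat \<Rightarrow> nat" where
  "erdos_rogers s t m =
     Min {indep_num s G |G :: nat sgraph.
            fin_simple_graph G \<and> card (verts G) = m \<and> free_of G (complete_graph t)}"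

(* The following facts show that every Max and Min above is taken over a finite, nonempty set
   (for s \<ge> 1 and t \<ge> 2). *)

lemma indep_num_set:
  assumes "fin_simple_graph G" "s \<ge> 1"
  defines "X \<equiv> {card S |S. S \<subseteq> verts G \<and> free_of (induced_subgraph G S) (complete_graph s)}"
  shows "finite X" "X \<noteq> {}"
proof -
  have "X \<subseteq> card ` Pow (verts G)" unfolding X_def by blast
  then show "finite X"
    using assms(1) by (meson finite_Pow_iff finite_imageI finite_subset fin_simple_graph_def)
  have "{..<s} \<noteq> {}" using assms(2) by (auto simp: lessThan_empty_iff)
  then have "free_of (induced_subgraph G {}) (complete_graph s)"
    by (auto simp: contains_copy_def induced_subgraph_def complete_graph_def)
  then show "X \<noteq> {}" unfolding X_def by blast
qed

lemma indep_num_le_card: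
  assumes "fin_simple_graph G" "s \<ge> 1"
  shows "indep_num s G \<le> card (verts G)"
proof -
  have "finite (verts G)" using assms(1) by (simp add: fin_simple_graph_def)
  then show ?thesis
    unfolding indep_num_def using indep_num_set[OF assms] by (auto intro: card_mono)
qed

lemma finite_RT_graphs_edges: "finite ((\<lambda>G. card (edges G)) ` RT_graphs s n H x)"
proof (rule finite_subset)
  show "(\<lambda>G. card (edges G)) ` RT_graphs s n H x \<subseteq> {..n choose 2}"
  proof (rule image_subsetI)
    fix G assume "G \<in> RT_graphs s n H x"
    then have *: "finite (verts G)" "edges G \<subseteq> nsets (verts G) 2" "card (verts G) = n"
      by (auto simp: RT_graphs_def fin_simple_graph_def)
    then have "card (edges G) \<le> card (nsets (verts G) 2)"
      by (meson card_mono finite_imp_finite_nsets)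
    then show "card (edges G) \<in> {..n choose 2}" using * by (simp add: card_nsets)
  qed
qed simp

lemma erdos_rogers_set:
  fixes s t m :: nat
  assumes "s \<ge> 1" "t \<ge> 2"
  defines "X \<equiv> {indep_num s G |G :: nat sgraph.
            fin_simple_graph G \<and> card (verts G) = m \<and> free_of G (complete_graph t)}"
  shows "finite X" "X \<noteq> {}"
proof -
  have "X \<subseteq> {..m}" unfolding X_def using indep_num_le_card[OF _ assms(1)] by auto
  then show "finite X" using finite_subset by blast
  let ?G = "({..<m}, {}) :: nat sgraph"
  have "{0, 1} \<in> edges (complete_graph t)"
    using assms(2) by (auto simp: complete_graph_def nsets_def)
  then have "free_of ?G (complete_graph t)" by (auto simp: contains_copy_def)
  moreover have "fin_simple_graph ?G" "card (verts ?G) = m" by (auto simp: fin_simple_graph_def)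
  ultimately show "X \<noteq> {}" unfolding X_def by blast
qed

end

(* Lower bound: join k copies of an optimal graph for f_{s,s+1}(n/k). A clique takes at most s
   vertices from each copy. A K_s-free set restricts to a K_s-free set in each copy, and for s = 2 it
   lies in a single copy, which is why c > 1 is enough there. Since f_{s,s+1} tends to infinity by
   Ramsey's theorem, the rounding of n/k costs only a constant that c absorbs.

   Upper bound: f_{s,s+1}(m) = o(m), so it is enough that a dense K_{ks+1}-free graph has
   s-independence number linear in n. Pass to a subgraph on linearly many vertices of minimum degree
   about (1 - 1/k + eps) times its order. If Q is a largest clique there, linearly many vertices
   have more than (1 - 1/k)|Q| neighbours in Q, hence linearly many have the same neighbourhood A in
   Q. If these vertices spanned a K_s, it would form with A a clique of more than
   |Q| - |Q|/k + s >= |Q| vertices.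

   For f_{s,s+1}(m) = o(m), take K m random s-tuples of vertices: with positive probability every set
   of delta m vertices contains one of them, while the expected number of repeated vertices, of
   pairs of tuples sharing two vertices and of triangles of tuples is bounded. Isolate one vertex of
   each of these bad configurations and turn the surviving tuples into cliques. *)
theory Submission
  imports Defs
begin

section \<open>Clique-free sets\<close>

text \<open>Edges come from the ambient \<open>E\<close>, so one predicate serves both for a graph
  and for each of its induced subgraphs.\<close>

definition clique_free :: "nat \<Rightarrow> 'a set set \<Rightarrow> 'a set \<Rightarrow> bool" where
  "clique_free t E S \<longleftrightarrow> \<not> (\<exists>Q\<subseteq>S. finite Q \<and> card Q = t \<and> clique Q E)"

lemma clique_card_less:
  assumes "clique_free t E S" "Q \<subseteq> S" "finite Q" "clique Q E"
  shows "card Q < t"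
proof (rule ccontr)
  assume "\<not> card Q < t"
  then obtain R where "R \<subseteq> Q" "card R = t"
    by (meson not_less obtain_subset_with_card_n)
  moreover from this have "finite R" "clique R E"
    using assms(3,4) by (auto intro: finite_subset smaller_clique)
  ultimately show False
    using assms(1,2) unfolding clique_free_def by blast
qed

lemma clique_free_mono: "clique_free t E S \<Longrightarrow> t \<le> u \<Longrightarrow> clique_free u E S"
  using clique_card_less unfolding clique_free_def by fastforce

text \<open>The image of an embedding is a clique, and an enumeration of a clique is an embedding.
  From here on, copies of complete graphs are plain vertex sets.\<close>

lemma contains_copy_complete_graph:
  "contains_copy (V, E) (complete_graph t)
     \<longleftrightarrow> (\<exists>Q\<subseteq>V. finite Q \<and> card Q = t \<and> clique Q E)" (is "?L \<longleftrightarrow> ?R")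
proof
  assume ?L
  then obtain \<phi> where \<phi>: "inj_on \<phi> {..<t}" "\<phi> ` {..<t} \<subseteq> V"
    and E: "\<And>e. e \<in> nsets {..<t} 2 \<Longrightarrow> \<phi> ` e \<in> E"
    by (auto simp: contains_copy_def complete_graph_def)
  have "clique (\<phi> ` {..<t}) E"
    unfolding clique_def
  proof (intro ballI impI)
    fix v w assume "v \<in> \<phi> ` {..<t}" "w \<in> \<phi> ` {..<t}" "v \<noteq> w"
    then obtain a b where ab: "a < t" "b < t" "a \<noteq> b" "v = \<phi> a" "w = \<phi> b" by auto
    then show "{v, w} \<in> E" using E[of "{a, b}"] by simp
  qed
  then show ?R using \<phi> by (metis card_image card_lessThan finite_imageI finite_lessThan)
next
  assume ?R
  then obtain Q where Q: "Q \<subseteq> V" "finite Q" "card Q = t" "clique Q E" by blast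
  then obtain \<phi> where \<phi>: "bij_betw \<phi> {..<t} Q"
    by (metis atLeast0LessThan ex_bij_betw_nat_finite)
  have "\<phi> ` e \<in> E" if "e \<in> nsets {..<t} 2" for e
  proof -
    from that obtain a b where "e = {a, b}" "a < t" "b < t" "a \<noteq> b"
      by (auto elim!: nsets2_E)
    then show ?thesis
      using \<phi> Q(4) by (auto simp: clique_def bij_betw_def inj_on_def)
  qed
  then show ?L
    using \<phi> Q(1) by (auto simp: contains_copy_def complete_graph_def bij_betw_def)
qed

lemma free_of_complete_graph: "free_of G (complete_graph t) \<longleftrightarrow> clique_free t (edges G) (verts G)"
  using contains_copy_complete_graph[of "verts G" "edges G" t] by (simp add: clique_free_def)

lemma free_of_induced_subgraph:
  "free_of (induced_subgraph G S) (complete_graph t) \<longleftrightarrow> clique_free t (edges G) S"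
proof -
  have "clique Q {e \<in> edges G. e \<subseteq> S} \<longleftrightarrow> clique Q (edges G)" if "Q \<subseteq> S" for Q
    using that by (auto simp: clique_def)
  then show ?thesis
    unfolding clique_free_def induced_subgraph_def contains_copy_complete_graph by blast
qed

section \<open>Access to the extremal quantities without \<open>Max\<close> and
  \<open>Min\<close>\<close>

lemma card_le_indep_num:
  assumes "fin_simple_graph G" "s \<ge> 1" "S \<subseteq> verts G" "clique_free s (edges G) S"
  shows "card S \<le> indep_num s G"
  unfolding indep_num_def
  using indep_num_set(1)[OF assms(1,2)] assms(3,4)
  by (intro Max_ge) (auto simp: free_of_induced_subgraph)

lemma indep_num_le:
  assumes "fin_simple_graph G" "s \<ge> 1"
    and "\<And>S. S \<subseteq> verts G \<Longrightarrow> clique_free s (edges G) S \<Longrightarrow> card S \<le> b"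
  shows "indep_num s G \<le> b"
  unfolding indep_num_def
  using indep_num_set[OF assms(1,2)] assms(3)
  by (subst Max_le_iff) (auto simp: free_of_induced_subgraph)

lemma erdos_rogers_le:
  fixes G :: "nat sgraph"
  assumes "s \<ge> 1" "t \<ge> 2" "fin_simple_graph G" "card (verts G) = m"
    "clique_free t (edges G) (verts G)"
  shows "erdos_rogers s t m \<le> indep_num s G"
proof -
  have "free_of G (complete_graph t)" using assms(5) by (simp add: free_of_complete_graph)
  then show ?thesis
    unfolding erdos_rogers_def
    using assms(3,4) by (intro Min_le erdos_rogers_set(1)[OF assms(1,2)]) blast
qed

lemma erdos_rogers_attained:
  assumes "s \<ge> 1" "t \<ge> 2"
  obtains G :: "nat sgraph" where "fin_simple_graph G" "card (verts G) = m"
    "clique_free t (edges G) (verts G)" "indep_num s G = erdos_rogers s t m"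
proof -
  have "erdos_rogers s t m \<in> {indep_num s G |G :: nat sgraph.
      fin_simple_graph G \<and> card (verts G) = m \<and> free_of G (complete_graph t)}"
    unfolding erdos_rogers_def by (rule Min_in[OF erdos_rogers_set[OF assms]])
  then show thesis using that unfolding free_of_complete_graph by force
qed

text \<open>Ramsey's theorem yields a clique on s + 1 vertices, which is excluded, or an independent
  set on \<open>L\<close> vertices. Growth is what lets a constant factor \<open>c\<close> absorb
  additive rounding errors later.\<close>

lemma erdos_rogers_unbounded:
  assumes "s \<ge> 2"
  obtains N where "\<And>m. m \<ge> N \<Longrightarrow> erdos_rogers s (s + 1) m \<ge> L"
proof -
  obtain N where N: "\<forall>(V::nat set) E. finite V \<and> card V \<ge> N \<longrightarrow>
      (\<exists>R \<subseteq> V. card R = s + 1 \<and> clique R E \<or> card R = L \<and> indep R E)"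
    using ramsey2[where ?'a = nat, of "s + 1" L] by (elim exE conjE)
  have "erdos_rogers s (s + 1) m \<ge> L" if "m \<ge> N" for m
  proof -
    obtain G :: "nat sgraph" where G: "fin_simple_graph G" "card (verts G) = m"
      "clique_free (s + 1) (edges G) (verts G)" "indep_num s G = erdos_rogers s (s + 1) m"
      by (rule erdos_rogers_attained[of s "s + 1" m]) (use assms in auto)
    have fin: "finite (verts G)" using G(1) by (simp add: fin_simple_graph_def)
    have "\<exists>R\<subseteq>verts G. card R = s + 1 \<and> clique R (edges G) \<or> card R = L \<and> indep R (edges G)"
      using N fin G(2) that by simp
    then obtain R where R: "R \<subseteq> verts G"
      "card R = s + 1 \<and> clique R (edges G) \<or> card R = L \<and> indep R (edges G)"
      by (elim exE conjE)
    have "\<not> (card R = s + 1 \<and> clique R (edges G))"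
      using G(3) R(1) finite_subset[OF R(1) fin] unfolding clique_free_def by blast
    then have R': "card R = L" "indep R (edges G)" using R(2) by blast+
    \<comment> \<open>Here \<open>s \<ge> 2\<close> enters: a K_s would contain two adjacent
      vertices of the independent set.\<close>
    have "clique_free s (edges G) R"
      unfolding clique_free_def
    proof clarify
      fix Q assume Q: "Q \<subseteq> R" "finite Q" "clique Q (edges G)" "s = card Q"
      then obtain x y where "x \<in> Q" "y \<in> Q" "x \<noteq> y"
        using assms by (metis card_le_Suc0_iff_eq not_less_eq_eq numeral_2_eq_2)
      with Q R'(2) show False unfolding clique_def indep_def by blast
    qed
    then show ?thesis using card_le_indep_num[OF G(1) _ R(1), of s] G(4) R'(1) assms by simp
  qed
  then show thesis using that by blast
qed

section \<open>Dense graphs without large cliques\<close>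

lemma real_choose_two: "real (n choose 2) = real n * (real n - 1) / 2"
  by (induction n) (auto simp: numeral_2_eq_2 field_simps)

text \<open>Choose \<open>S\<close> to maximise the number of edges minus a|S|^2/2. Comparison with
  the whole vertex set gives the edge bound, comparison with \<open>S - {v}\<close> the degree
  bound; \<open>a / 2\<close> is what remains from the difference of the two squares. The surplus
  \<open>\<eta>\<close> later forces \<open>S\<close> to be large.\<close>

lemma dense_subgraph_min_degree:
  fixes a \<eta> :: real
  assumes "finite V" "E \<subseteq> nsets V 2"
    and dense: "real (card E) \<ge> a * (real (card V))\<^sup>2 / 2 + \<eta>"
  obtains S where "S \<subseteq> V" "real (card {e \<in> E. e \<subseteq> S}) \<ge> a * (real (card S))\<^sup>2 / 2 + \<eta>"
    "\<And>v. v \<in> S \<Longrightarrow> real (card {w \<in> S. {v, w} \<in> E}) \<ge> a * real (card S) - a / 2"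
proof -
  define f where "f S = real (card {e \<in> E. e \<subseteq> S}) - a * (real (card S))\<^sup>2 / 2" for S
  have fin: "finite (f ` Pow V)" "f ` Pow V \<noteq> {}" using assms(1) by auto
  obtain S where S: "S \<subseteq> V" "f S = Max (f ` Pow V)"
    using Max_in[OF fin] by auto
  have max: "f T \<le> f S" if "T \<subseteq> V" for T
    using fin(1) that S(2) by auto
  have finE: "finite E"
    using assms(1,2) by (meson finite_imp_finite_nsets finite_subset)
  have finS: "finite S" using S(1) assms(1) finite_subset by blast
  have "{e \<in> E. e \<subseteq> V} = E" using assms(2) by (auto simp: nsets_def)
  then have "\<eta> \<le> f V" using dense by (simp add: f_def)
  also have "\<dots> \<le> f S" by (rule max) simp
  finally have 1: "real (card {e \<in> E. e \<subseteq> S}) \<ge> a * (real (card S))\<^sup>2 / 2 + \<eta>"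
    by (simp add: f_def)
  have 2: "real (card {w \<in> S. {v, w} \<in> E}) \<ge> a * real (card S) - a / 2" if v: "v \<in> S" for v
  proof -
    have "{e \<in> E. e \<subseteq> S} \<subseteq> {e \<in> E. e \<subseteq> S - {v}} \<union> (\<lambda>w. {v, w}) ` {w \<in> S. {v, w} \<in> E}"
    proof
      fix e assume "e \<in> {e \<in> E. e \<subseteq> S}"
      then have e: "e \<in> E" "e \<subseteq> S" by auto
      then obtain x y where "e = {x, y}" "x \<noteq> y"
        using assms(2) by (blast elim: nsets2_E)
      with e show "e \<in> {e \<in> E. e \<subseteq> S - {v}} \<union> (\<lambda>w. {v, w}) ` {w \<in> S. {v, w} \<in> E}"
        by (cases "v = x"; cases "v = y") (auto simp: insert_commute)
    qed
    then have "card {e \<in> E. e \<subseteq> S}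
        \<le> card ({e \<in> E. e \<subseteq> S - {v}} \<union> (\<lambda>w. {v, w}) ` {w \<in> S. {v, w} \<in> E})"
      using finE finS by (intro card_mono) auto
    also have "\<dots> \<le> card {e \<in> E. e \<subseteq> S - {v}} + card ((\<lambda>w. {v, w}) ` {w \<in> S. {v, w} \<in> E})"
      by (rule card_Un_le)
    also have "\<dots> \<le> card {e \<in> E. e \<subseteq> S - {v}} + card {w \<in> S. {v, w} \<in> E}"
      using finS by (simp add: card_image_le)
    finally have le: "real (card {e \<in> E. e \<subseteq> S})
        \<le> real (card {e \<in> E. e \<subseteq> S - {v}}) + real (card {w \<in> S. {v, w} \<in> E})"
      by linarith
    have "f (S - {v}) \<le> f S" using S(1) by (intro max) auto
    moreover have "real (card (S - {v})) = real (card S) - 1"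
      using v finS by (metis One_nat_def card_Suc_Diff1 add_diff_cancel_left' of_nat_Suc)
    ultimately show ?thesis using le by (simp add: f_def power2_eq_square field_simps)
  qed
  show thesis using that S(1) 1 2 by blast
qed

text \<open>Count adjacent pairs between \<open>Q\<close> and \<open>S\<close> twice. A vertex
  outside the set in question has at most (1 - 1/k)|Q| neighbours in \<open>Q\<close>, one inside at
  most |Q|; dividing by |Q| leaves \<open>\<beta>\<close>. The threshold (1 - 1/k)|Q| is multiplied
  by k to stay within natural numbers.\<close>

lemma card_many_neighbours:
  fixes \<beta> :: real
  assumes "finite S" "Q \<subseteq> S" "Q \<noteq> {}" "k \<ge> 1"
    and deg: "\<And>x. x \<in> Q \<Longrightarrow>
      real (card {w \<in> S. {x, w} \<in> E}) \<ge> (1 - 1 / real k) * real (card S) + \<beta>"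
  shows "\<beta> \<le> real (card {v \<in> S. (k - 1) * card Q < k * card {x \<in> Q. {x, v} \<in> E}})"
    (is "_ \<le> real (card ?B)")
proof -
  have finQ: "finite Q" using assms finite_subset by blast
  let ?q = "real (card Q)"
  have q: "?q > 0" using finQ assms(3) by (simp add: card_gt_0_iff)
  have "?q * ((1 - 1 / real k) * real (card S) + \<beta>) \<le> (\<Sum>x\<in>Q. real (card {w \<in> S. {x, w} \<in> E}))"
    using sum_mono[of Q "\<lambda>_. (1 - 1 / real k) * real (card S) + \<beta>"] deg by auto
  also have "\<dots> = real (\<Sum>v\<in>S. card {x \<in> Q. {x, v} \<in> E})"
    using sum_multicount_gen[OF finQ assms(1), of "\<lambda>x v. {x, v} \<in> E" "\<lambda>v. card {x \<in> Q. {x, v} \<in> E}"]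
    by (simp flip: of_nat_sum)
  also have "\<dots> \<le> (\<Sum>v\<in>S. (1 - 1 / real k) * ?q + (if v \<in> ?B then ?q else 0))"
    unfolding of_nat_sum
  proof (rule sum_mono)
    fix v assume v: "v \<in> S"
    have le: "card {x \<in> Q. {x, v} \<in> E} \<le> card Q" using finQ by (auto intro: card_mono)
    show "real (card {x \<in> Q. {x, v} \<in> E}) \<le> (1 - 1 / real k) * ?q + (if v \<in> ?B then ?q else 0)"
    proof (cases "v \<in> ?B")
      case True
      moreover have "(1 - 1 / real k) * ?q \<ge> 0" using assms(4) by simp
      ultimately show ?thesis using le by simp
    next
      case False
      then have "k * card {x \<in> Q. {x, v} \<in> E} \<le> (k - 1) * card Q" using v by simp
      then have "real (k * card {x \<in> Q. {x, v} \<in> E}) \<le> real ((k - 1) * card Q)"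
        unfolding of_nat_le_iff .
      then have "real k * real (card {x \<in> Q. {x, v} \<in> E}) \<le> (real k - 1) * ?q"
        using assms(4) by (simp add: of_nat_diff)
      then have "real (card {x \<in> Q. {x, v} \<in> E}) \<le> (1 - 1 / real k) * ?q"
        using assms(4) by (simp add: field_simps)
      then show ?thesis by (simp only: False if_False add_0_right)
    qed
  qed
  also have "\<dots> = ?q * ((1 - 1 / real k) * real (card S) + real (card ?B))"
  proof -
    have "(\<Sum>v\<in>S. if v \<in> ?B then ?q else 0) = (\<Sum>v\<in>S \<inter> ?B. ?q)"
      using assms(1) by (rule sum.inter_restrict[symmetric])
    also have "S \<inter> ?B = ?B" by blast
    finally show ?thesis by (simp only: sum.distrib sum_constant) (simp add: algebra_simps)
  qed
  finally show ?thesis using q by simp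
qed

text \<open>One factor \<open>\<epsilon>\<close> is lost in passing to the subgraph, the other in
  passing to the vertices with many neighbours in its largest clique; 2^(ks) bounds the number of
  possible neighbourhoods in that clique.\<close>

lemma indep_num_large_if_dense:
  fixes G :: "'a sgraph" and \<epsilon> :: real
  assumes G: "fin_simple_graph G" and "k \<ge> 1" "s \<ge> 1" "0 < \<epsilon>" "\<epsilon> \<le> 1"
    and cf: "clique_free (k * s + 1) (edges G) (verts G)"
    and dense: "real (card (edges G))
      \<ge> 1 / 2 * (1 - 1 / real k) * (real (card (verts G)))\<^sup>2 + \<epsilon> * (real (card (verts G)))\<^sup>2"
  shows "\<epsilon>\<^sup>2 * real (card (verts G)) - 1 \<le> 2 ^ (k * s) * real (indep_num s G)"
proof (cases "card (verts G) = 0")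
  case True
  have "0 \<le> 2 ^ (k * s) * real (indep_num s G)" by simp
  then show ?thesis by (rule order_trans[rotated]) (simp add: True)
next
  case False
  define n where "n = real (card (verts G))"
  define E where "E = edges G"
  define a where "a = 1 - 1 / real k + \<epsilon>"
  have n: "n > 0" using False by (simp add: n_def)
  have "0 \<le> 1 / real k" "1 / real k \<le> 1" using assms(2) by auto
  then have a: "0 \<le> a" "a \<le> 2" using assms(4,5) unfolding a_def by linarith+
  have V: "finite (verts G)" "E \<subseteq> nsets (verts G) 2"
    using G by (auto simp: fin_simple_graph_def E_def)
  \<comment> \<open>Half of the surplus \<epsilon> n^2 raises the density to \<open>a\<close>, the
    other half remains as \<open>\<eta>\<close>.\<close>
  have "real (card E) \<ge> a * (real (card (verts G)))\<^sup>2 / 2 + \<epsilon> * n\<^sup>2 / 2"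
    using dense by (simp add: E_def n_def a_def field_simps)
  then obtain S where S: "S \<subseteq> verts G"
    and eS: "real (card {e \<in> E. e \<subseteq> S}) \<ge> a * (real (card S))\<^sup>2 / 2 + \<epsilon> * n\<^sup>2 / 2"
    and deg: "\<And>v. v \<in> S \<Longrightarrow> real (card {w \<in> S. {v, w} \<in> E}) \<ge> a * real (card S) - a / 2"
    using dense_subgraph_min_degree[OF V] by blast
  have finS: "finite S" using S V(1) finite_subset by blast
  have "{e \<in> E. e \<subseteq> S} \<subseteq> nsets S 2" using V(2) by (auto simp: nsets_def)
  then have "card {e \<in> E. e \<subseteq> S} \<le> card (nsets S 2)"
    using finS by (intro card_mono) (auto simp: finite_imp_finite_nsets)
  also have "\<dots> = card S choose 2" using card_nsets by blast
  finally have "real (card {e \<in> E. e \<subseteq> S}) \<le> real (card S choose 2)" by simp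
  also have "\<dots> \<le> (real (card S))\<^sup>2 / 2"
    by (simp add: real_choose_two power2_eq_square field_simps)
  \<comment> \<open>A graph on |S| vertices has at most |S|^2/2 edges, so the surplus cannot survive
    on a small \<open>S\<close>.\<close>
  finally have "\<epsilon> * n\<^sup>2 \<le> (1 - a) * (real (card S))\<^sup>2" using eS by (simp add: field_simps)
  also have "\<dots> \<le> 1 * (real (card S))\<^sup>2" using a by (intro mult_right_mono) auto
  finally have S2: "\<epsilon> * n\<^sup>2 \<le> (real (card S))\<^sup>2" by simp
  \<comment> \<open>Replacing \<epsilon> by its square makes the left side a square, so that roots
    can be taken.\<close>
  have "\<epsilon>\<^sup>2 * n\<^sup>2 \<le> \<epsilon> * n\<^sup>2"
    using assms(4,5) by (intro mult_right_mono) (auto simp: power2_eq_square mult_left_le_one_le)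
  then have "(\<epsilon> * n)\<^sup>2 \<le> \<epsilon> * n\<^sup>2" by (simp add: power_mult_distrib)
  with S2 have "(\<epsilon> * n)\<^sup>2 \<le> (real (card S))\<^sup>2" by linarith
  then have cS: "\<epsilon> * n \<le> real (card S)" by (rule power2_le_imp_le) simp
  have "S \<noteq> {}" using cS n assms(4) by (auto simp: mult_le_0_iff)
  then obtain v0 where v0: "v0 \<in> S" by blast

  have "\<exists>Q. (Q \<subseteq> S \<and> clique Q E) \<and> (\<forall>R. R \<subseteq> S \<and> clique R E \<longrightarrow> card R \<le> card Q)"
    by (rule ex_has_greatest_nat[where k = "{}" and b = "Suc (card S)"])
      (use finS in \<open>auto simp: less_Suc_eq_le card_mono\<close>)
  then obtain Q where Q: "Q \<subseteq> S" "clique Q E"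
    and Qmax: "\<And>R. R \<subseteq> S \<Longrightarrow> clique R E \<Longrightarrow> card R \<le> card Q" by blast
  have finQ: "finite Q" using Q(1) finS finite_subset by blast
  have "card {v0} \<le> card Q" using v0 by (intro Qmax) (auto simp: clique_def)
  then have Q0: "Q \<noteq> {}" by auto
  have qks: "card Q \<le> k * s"
    using clique_card_less[OF cf, of Q] Q finQ S by (fastforce simp: E_def)
  define N where "N v = {x \<in> Q. {x, v} \<in> E}" for v
  define B where "B = {v \<in> S. (k - 1) * card Q < k * card (N v)}"
  \<comment> \<open>The loss of 1 covers the \<open>a / 2\<close> in the degree bound, as a \<le>
    2.\<close>
  have "\<epsilon> * real (card S) - 1 \<le> real (card B)"
    unfolding B_def N_def
  proof (rule card_many_neighbours[OF finS Q(1) Q0 assms(2)])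
    fix x assume "x \<in> Q"
    then have "a * real (card S) - a / 2 \<le> real (card {w \<in> S. {x, w} \<in> E})" using deg Q(1) by blast
    moreover have "(1 - 1 / real k) * real (card S) + (\<epsilon> * real (card S) - 1)
        = a * real (card S) - 1"
      by (simp add: a_def algebra_simps)
    ultimately show "(1 - 1 / real k) * real (card S) + (\<epsilon> * real (card S) - 1)
        \<le> real (card {w \<in> S. {x, w} \<in> E})"
      using a by linarith
  qed
  moreover have "\<epsilon> * (\<epsilon> * n) \<le> \<epsilon> * real (card S)" using cS assms(4) by (intro mult_left_mono) auto
  ultimately have cB: "\<epsilon>\<^sup>2 * n - 1 \<le> real (card B)" by (simp add: power2_eq_square algebra_simps)
  \<comment> \<open>Vertices with common neighbourhood \<open>A\<close> in \<open>Q\<close> are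
    joined completely to the clique \<open>A\<close>, so a K_s among them would enlarge
    \<open>A\<close> to a clique with s more vertices.\<close>
  have small: "card {v \<in> B. N v = A} \<le> indep_num s G" for A
  proof (rule card_le_indep_num[OF G assms(3)])
    show "{v \<in> B. N v = A} \<subseteq> verts G" using S by (auto simp: B_def)
    show "clique_free s (edges G) {v \<in> B. N v = A}"
      unfolding clique_free_def
    proof clarify
      fix K assume K: "K \<subseteq> {v \<in> B. N v = A}" "finite K" "clique K (edges G)" "s = card K"
      then obtain v where v: "v \<in> K" using assms(3) by (metis card.empty ex_in_conv not_one_le_zero)
      have KA: "{x, w} \<in> E" if "x \<in> A" "w \<in> K" for x w
        using that K(1) by (auto simp: N_def)
      have A: "A = N v" "A \<subseteq> Q" "(k - 1) * card Q < k * card A"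
        using v K(1) by (auto simp: N_def B_def)
      have "A \<inter> K = {}"
      proof (rule ccontr)
        assume "A \<inter> K \<noteq> {}"
        then obtain x where "{x, x} \<in> E" using KA by blast
        then have "{x, x} \<in> nsets (verts G) 2" using V(2) by blast
        then show False by (auto simp: nsets_def)
      qed
      then have "card (A \<union> K) = card A + s"
        using K(2,4) finQ A(2) by (simp add: card_Un_disjoint finite_subset)
      moreover have "card (A \<union> K) \<le> card Q"
      proof (rule Qmax)
        show "A \<union> K \<subseteq> S" using A(2) Q(1) K(1) by (auto simp: B_def)
        show "clique (A \<union> K) E"
          using KA K(3) smaller_clique[OF Q(2) A(2)] by (intro clique_Un) (auto simp: E_def)
      qed
      \<comment> \<open>Maximality of \<open>Q\<close> gives k(|A| + s) \<le> (k - 1)|Q| + |Q|, but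
        (k - 1)|Q| < k|A| and |Q| \<le> ks make the right side smaller than k|A| + ks.\<close>
      ultimately have "k * (card A + s) \<le> k * card Q" by simp
      moreover have "k * card Q = (k - 1) * card Q + card Q"
        using assms(2) by (cases k) auto
      ultimately show False using A(3) qks unfolding distrib_left by linarith
    qed
  qed
  \<comment> \<open>Pigeonhole: sort \<open>B\<close> by neighbourhood in \<open>Q\<close>, with at
    most 2^|Q| classes.\<close>
  have "N v \<subseteq> Q" for v by (auto simp: N_def)
  then have "B \<subseteq> (\<Union>A\<in>Pow Q. {v \<in> B. N v = A})" by blast
  then have "card B \<le> card (\<Union>A\<in>Pow Q. {v \<in> B. N v = A})"
    using finQ finS by (intro card_mono) (auto simp: B_def)
  also have "\<dots> \<le> (\<Sum>A\<in>Pow Q. card {v \<in> B. N v = A})"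
    using finQ by (intro card_UN_le) simp
  also have "\<dots> \<le> (\<Sum>A\<in>Pow Q. indep_num s G)" by (intro sum_mono small)
  also have "\<dots> = 2 ^ card Q * indep_num s G" using finQ by (simp add: card_Pow)
  also have "\<dots> \<le> 2 ^ (k * s) * indep_num s G" using qks by (intro mult_right_mono power_increasing) auto
  finally have "real (card B) \<le> real (2 ^ (k * s) * indep_num s G)" by (rule of_nat_mono)
  with cB show ?thesis by (simp add: n_def)
qed

section \<open>Sublinearity of the numbers of Erdos and Rogers\<close>

text \<open>The sample space of the random construction: M tuples with repetitions allowed, all
  coordinates independent and uniform. Probabilities are expressed as counts relative to
  N^(Ms).\<close>

definition tuple_systems :: "nat \<Rightarrow> nat \<Rightarrow> nat \<Rightarrow> (nat \<Rightarrow> nat \<Rightarrow> nat) set" where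
  "tuple_systems M s N = (\<Pi>\<^sub>E i\<in>{..<M}. \<Pi>\<^sub>E a\<in>{..<s}. {..<N})"

text \<open>A list of equations between coordinates, where position (i, a) stands for entry a of
  tuple i. The length counts the equations, and the head marks the vertex to be isolated.\<close>

type_synonym coincidence = "((nat \<times> nat) \<times> (nat \<times> nat)) list"

definition satisfies :: "(nat \<Rightarrow> nat \<Rightarrow> nat) \<Rightarrow> coincidence \<Rightarrow> bool" where
  "satisfies \<omega> c \<longleftrightarrow> (\<forall>p\<in>set c. case_prod \<omega> (fst p) = case_prod \<omega> (snd p))"

lemma finite_tuple_systems [simp]: "finite (tuple_systems M s N)"
  by (simp add: tuple_systems_def finite_PiE)

lemma card_tuple_systems: "card (tuple_systems M s N) = N ^ (M * s)"
  by (simp add: tuple_systems_def card_PiE mult.commute flip: power_mult)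

text \<open>Each equation determines its left coordinate from its right one. As left positions are
  distinct and never occur on the right, the other coordinates determine the whole system. Thus p
  such equations hold with probability at most N^(-p).\<close>

lemma card_satisfies:
  assumes "distinct (map fst c)" "fst ` set c \<inter> snd ` set c = {}"
    and I: "set c \<subseteq> ({..<M} \<times> {..<s}) \<times> ({..<M} \<times> {..<s})"
  shows "card {\<omega> \<in> tuple_systems M s N. satisfies \<omega> c} * N ^ length c \<le> N ^ (M * s)"
proof -
  let ?I = "{..<M} \<times> {..<s}"
  let ?X = "fst ` set c"
  let ?A = "{\<omega> \<in> tuple_systems M s N. satisfies \<omega> c}"
  let ?h = "\<lambda>\<omega>. restrict (case_prod \<omega>) (?I - ?X)"
  have XI: "?X \<subseteq> ?I" using I by auto
  have X: "card ?X = length c" using distinct_card[OF assms(1)] by simp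
  have "inj_on ?h ?A"
  proof (rule inj_onI)
    fix \<omega> \<omega>' assume w: "\<omega> \<in> ?A" "\<omega>' \<in> ?A" "?h \<omega> = ?h \<omega>'"
    have out: "case_prod \<omega> p = case_prod \<omega>' p" if "p \<in> ?I - ?X" for p
      using fun_cong[OF w(3), of p] that by (simp only: restrict_apply if_True)
    have eq: "case_prod \<omega> p = case_prod \<omega>' p" if p: "p \<in> ?I" for p
    proof (cases "p \<in> ?X")
      case True
      then obtain y where y: "(p, y) \<in> set c" by auto
      then have "y \<in> ?I - ?X" using assms(2) I by force
      moreover have "case_prod \<omega> p = case_prod \<omega> y" "case_prod \<omega>' p = case_prod \<omega>' y"
        using w(1,2) y unfolding satisfies_def by fastforce+
      ultimately show ?thesis using out[of y] by simp
    qed (use out p in blast)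
    show "\<omega> = \<omega>'"
    proof (rule PiE_ext)
      show "\<omega> \<in> (\<Pi>\<^sub>E i\<in>{..<M}. \<Pi>\<^sub>E a\<in>{..<s}. {..<N})" "\<omega>' \<in> (\<Pi>\<^sub>E i\<in>{..<M}. \<Pi>\<^sub>E a\<in>{..<s}. {..<N})"
        using w(1,2) by (simp_all add: tuple_systems_def)
      fix i assume i: "i \<in> {..<M}"
      show "\<omega> i = \<omega>' i"
      proof (rule PiE_ext)
        show "\<omega> i \<in> (\<Pi>\<^sub>E a\<in>{..<s}. {..<N})" "\<omega>' i \<in> (\<Pi>\<^sub>E a\<in>{..<s}. {..<N})"
          using w(1,2) i by (auto simp: tuple_systems_def)
      qed (use eq[of "(i, _)"] i in auto)
    qed
  qed
  moreover have "?h ` ?A \<subseteq> (\<Pi>\<^sub>E p\<in>?I - ?X. {..<N})"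
    unfolding image_subset_iff restrict_PiE by (auto simp: tuple_systems_def PiE_iff)
  ultimately have "card ?A \<le> card (\<Pi>\<^sub>E p\<in>?I - ?X. {..<N})"
    by (intro card_inj_on_le) (auto intro: finite_PiE)
  also have "\<dots> = N ^ (M * s - length c)"
    using XI X by (simp add: card_PiE card_Diff_subset)
  finally have "card ?A * N ^ length c \<le> N ^ (M * s - length c) * N ^ length c"
    by (rule mult_right_mono) simp
  also have "\<dots> = N ^ (M * s)"
    using card_mono[OF _ XI] X by (simp flip: power_add)
  finally show ?thesis .
qed

text \<open>In each of the three kinds of bad configuration, p tuples (p = 1, 2, 3) are tied by p
  equations. Hence O(M^p) candidates face a probability of at most N^(-p), and for M = K N their
  expected number stays bounded. The inequalities between indices make \<open>card_satisfies\<close>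
  applicable.\<close>

definition double_points :: "nat \<Rightarrow> nat \<Rightarrow> coincidence set" where
  "double_points M s = (\<lambda>(i, a, b). [((i, a), (i, b))]) `
     {(i, a, b). i < M \<and> a < s \<and> b < s \<and> a \<noteq> b}"

definition two_cycles :: "nat \<Rightarrow> nat \<Rightarrow> coincidence set" where
  "two_cycles M s = (\<lambda>(i, j, a, b, a', b'). [((i, a), (j, b)), ((i, a'), (j, b'))]) `
     {(i, j, a, b, a', b'). i < M \<and> j < M \<and> i \<noteq> j \<and>
        a < s \<and> b < s \<and> a' < s \<and> b' < s \<and> a \<noteq> a'}"

text \<open>The equations run around the cycle i, j, l, and each tuple contributes one left position
  and a different right position.\<close>

definition three_cycles :: "nat \<Rightarrow> nat \<Rightarrow> coincidence set" where
  "three_cycles M s =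
     (\<lambda>(i, j, l, a, b, b', c, c', a'). [((i, a), (j, b)), ((j, b'), (l, c)), ((l, c'), (i, a'))]) `
     {(i, j, l, a, b, b', c, c', a'). i < M \<and> j < M \<and> l < M \<and> i \<noteq> j \<and> j \<noteq> l \<and> l \<noteq> i \<and>
        a < s \<and> b < s \<and> b' < s \<and> c < s \<and> c' < s \<and> a' < s \<and> a \<noteq> a' \<and> b \<noteq> b' \<and> c \<noteq> c'}"

section \<open>Expected number of bad configurations\<close>

lemma double_points_bound:
  "finite (double_points M s) \<and> card (double_points M s) \<le> M * s\<^sup>2"
proof -
  let ?D = "{(i, a, b). i < M \<and> a < s \<and> b < s \<and> a \<noteq> b}"
  have D: "?D \<subseteq> {..<M} \<times> {..<s} \<times> {..<s}" by auto
  then have fin: "finite ?D" by (rule finite_subset) simp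
  have "card (double_points M s) \<le> card ?D"
    unfolding double_points_def using fin by (rule card_image_le)
  also have "\<dots> \<le> card ({..<M} \<times> {..<s} \<times> {..<s})" using D by (intro card_mono) auto
  finally show ?thesis using fin by (simp add: double_points_def power2_eq_square)
qed

lemma two_cycles_bound:
  "finite (two_cycles M s) \<and> card (two_cycles M s) \<le> (M * s\<^sup>2)\<^sup>2"
proof -
  let ?D = "{(i, j, a, b, a', b'). i < M \<and> j < M \<and> i \<noteq> j \<and>
        a < s \<and> b < s \<and> a' < s \<and> b' < s \<and> a \<noteq> a'}"
  have D: "?D \<subseteq> {..<M} \<times> {..<M} \<times> {..<s} \<times> {..<s} \<times> {..<s} \<times> {..<s}" by auto
  then have fin: "finite ?D" by (rule finite_subset) simp
  have "card (two_cycles M s) \<le> card ?D"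
    unfolding two_cycles_def using fin by (rule card_image_le)
  also have "\<dots> \<le> card ({..<M} \<times> {..<M} \<times> {..<s} \<times> {..<s} \<times> {..<s} \<times> {..<s})"
    using D by (intro card_mono) auto
  finally show ?thesis using fin by (simp add: two_cycles_def power2_eq_square mult_ac)
qed

lemma three_cycles_bound:
  "finite (three_cycles M s) \<and> card (three_cycles M s) \<le> (M * s\<^sup>2) ^ 3"
proof -
  let ?D = "{(i, j, l, a, b, b', c, c', a'). i < M \<and> j < M \<and> l < M \<and> i \<noteq> j \<and> j \<noteq> l \<and> l \<noteq> i \<and>
        a < s \<and> b < s \<and> b' < s \<and> c < s \<and> c' < s \<and> a' < s \<and> a \<noteq> a' \<and> b \<noteq> b' \<and> c \<noteq> c'}"
  let ?P = "{..<M} \<times> {..<M} \<times> {..<M} \<times> {..<s} \<times> {..<s} \<times> {..<s} \<times> {..<s} \<times> {..<s} \<times> {..<s}"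
  have D: "?D \<subseteq> ?P" by auto
  then have fin: "finite ?D" by (rule finite_subset) simp
  have "card (three_cycles M s) \<le> card ?D"
    unfolding three_cycles_def using fin by (rule card_image_le)
  also have "\<dots> \<le> card ?P" using D by (intro card_mono) auto
  finally show ?thesis
    using fin by (simp add: three_cycles_def power2_eq_square power3_eq_cube mult_ac)
qed

text \<open>Linearity of expectation as a double count of systems against coincidences. With K N
  tuples, the N^p in the number of coincidences cancels the probability N^(-p).\<close>

lemma sum_card_satisfies:
  assumes "finite C" "real (card C) \<le> (real K * real N * (real s)\<^sup>2) ^ p" "N \<ge> 1"
    and "\<And>c. c \<in> C \<Longrightarrow> length c = p \<and> distinct (map fst c) \<and> fst ` set c \<inter> snd ` set c = {} \<and>
      set c \<subseteq> ({..<K * N} \<times> {..<s}) \<times> ({..<K * N} \<times> {..<s})"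
  shows "(\<Sum>\<omega>\<in>tuple_systems (K * N) s N. real (card {c \<in> C. satisfies \<omega> c}))
    \<le> (real K * (real s)\<^sup>2) ^ p * real N ^ (K * N * s)"
proof -
  let ?\<Omega> = "tuple_systems (K * N) s N"
  have "(\<Sum>\<omega>\<in>?\<Omega>. card {c \<in> C. satisfies \<omega> c}) = (\<Sum>c\<in>C. card {\<omega> \<in> ?\<Omega>. satisfies \<omega> c})"
    using assms(1) by (intro sum_multicount_gen) auto
  then have "(\<Sum>\<omega>\<in>?\<Omega>. real (card {c \<in> C. satisfies \<omega> c}))
      = (\<Sum>c\<in>C. real (card {\<omega> \<in> ?\<Omega>. satisfies \<omega> c}))"
    by (simp flip: of_nat_sum)
  also have "\<dots> \<le> (\<Sum>c\<in>C. real N ^ (K * N * s) / real N ^ p)"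
  proof (rule sum_mono)
    fix c assume c: "c \<in> C"
    have "card {\<omega> \<in> ?\<Omega>. satisfies \<omega> c} * N ^ length c \<le> N ^ (K * N * s)"
      using assms(4)[OF c] by (intro card_satisfies) auto
    then have "real (card {\<omega> \<in> ?\<Omega>. satisfies \<omega> c} * N ^ p) \<le> real (N ^ (K * N * s))"
      using assms(4)[OF c] by (simp only: of_nat_le_iff)
    then show "real (card {\<omega> \<in> ?\<Omega>. satisfies \<omega> c}) \<le> real N ^ (K * N * s) / real N ^ p"
      using assms(3) by (simp add: pos_le_divide_eq)
  qed
  also have "\<dots> = real (card C) * (real N ^ (K * N * s) / real N ^ p)" by simp
  also have "\<dots> \<le> (real K * real N * (real s)\<^sup>2) ^ p * (real N ^ (K * N * s) / real N ^ p)"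
    by (rule mult_right_mono[OF assms(2)]) simp
  also have "\<dots> = (real K * (real s)\<^sup>2) ^ p * real N ^ (K * N * s)"
    using assms(3) by (simp add: power_mult_distrib)
  finally show ?thesis .
qed

text \<open>The tuples are independent, and those not inside \<open>S\<close> form the complement of
  a box of |S|^s tuples.\<close>

lemma card_missing_subset:
  assumes "S \<subseteq> {..<N}"
  shows "card {\<omega> \<in> tuple_systems M s N. \<forall>i<M. \<exists>a<s. \<omega> i a \<notin> S} \<le> (N ^ s - card S ^ s) ^ M"
proof -
  let ?F = "(\<Pi>\<^sub>E a\<in>{..<s}. {..<N}) - (\<Pi>\<^sub>E a\<in>{..<s}. S)"
  have fin: "finite S" using assms finite_subset by blast
  have "{\<omega> \<in> tuple_systems M s N. \<forall>i<M. \<exists>a<s. \<omega> i a \<notin> S} \<subseteq> (\<Pi>\<^sub>E i\<in>{..<M}. ?F)"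
  proof
    fix \<omega> assume w: "\<omega> \<in> {\<omega> \<in> tuple_systems M s N. \<forall>i<M. \<exists>a<s. \<omega> i a \<notin> S}"
    have "\<omega> i \<in> ?F" if "i < M" for i
      using w that by (auto simp: tuple_systems_def PiE_iff)
    then show "\<omega> \<in> (\<Pi>\<^sub>E i\<in>{..<M}. ?F)"
      using w by (auto simp: tuple_systems_def PiE_iff)
  qed
  then have "card {\<omega> \<in> tuple_systems M s N. \<forall>i<M. \<exists>a<s. \<omega> i a \<notin> S} \<le> card (\<Pi>\<^sub>E i\<in>{..<M}. ?F)"
    by (intro card_mono finite_PiE) (auto intro: finite_PiE)
  also have "\<dots> = card ?F ^ M" by (simp add: card_PiE)
  also have "card ?F = N ^ s - card S ^ s"
  proof (subst card_Diff_subset)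
    show "finite (\<Pi>\<^sub>E a\<in>{..<s}. S)" using fin by (auto intro: finite_PiE)
    show "(\<Pi>\<^sub>E a\<in>{..<s}. S) \<subseteq> (\<Pi>\<^sub>E a\<in>{..<s}. {..<N})" using assms by (intro PiE_mono) auto
  qed (simp add: card_PiE)
  finally show ?thesis .
qed

text \<open>A first-moment bound for the bad configurations is combined with a union bound over the
  large sets. The order of quantifiers matters: \<open>T\<close> does not depend on
  \<open>N\<close>.\<close>

lemma sparse_tuple_system_exists:
  fixes \<delta> :: real
  assumes "0 < \<delta>" "\<delta> \<le> 1" "s \<ge> 1"
  shows "\<exists>T::real. \<forall>N\<ge>1. \<exists>M \<omega> D. (\<forall>i<M. \<forall>a<s. \<omega> i a < N) \<and>
     finite D \<and> real (card D) \<le> T \<and>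
     (\<forall>c\<in>double_points M s \<union> two_cycles M s \<union> three_cycles M s.
        satisfies \<omega> c \<longrightarrow> case_prod \<omega> (fst (hd c)) \<in> D) \<and>
     (\<forall>S\<subseteq>{..<N}. real (card S) \<ge> \<delta> * real N \<longrightarrow> (\<exists>i<M. \<forall>a<s. \<omega> i a \<in> S))"
proof -
  have "\<delta> ^ s > 0" "\<delta> ^ s \<le> 1" using assms by (auto simp: power_le_one)
  then have d: "0 \<le> 1 - \<delta> ^ s" "1 - \<delta> ^ s < 1" by auto
  \<comment> \<open>With 1/4, a fixed large set is missed with probability at most 4^(-N), so the
    union bound over at most 2^N sets leaves 2^(-N) \<le> 1/2.\<close>
  then obtain K where K: "(1 - \<delta> ^ s) ^ K < 1 / 4"
    using real_arch_pow_inv[of "1 / 4" "1 - \<delta> ^ s"] by auto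
  define q where "q = real K * (real s)\<^sup>2"
  define T where "T = q + q ^ 2 + q ^ 3"
  show ?thesis
  \<comment> \<open>\<open>T\<close> bounds the mean of |D|; the factor 2 pays for keeping only half
    of the sample space.\<close>
  proof (intro exI[of _ "2 * T"] allI impI)
    fix N :: nat assume N: "N \<ge> 1"
    define M where "M = K * N"
    define \<Omega> where "\<Omega> = tuple_systems M s N"
    define C where "C = double_points M s \<union> two_cycles M s \<union> three_cycles M s"
    \<comment> \<open>One vertex from each bad configuration that occurs, namely the left end of its
      first equation.\<close>
    define D where "D \<omega> = (\<lambda>c. case_prod \<omega> (fst (hd c))) ` {c \<in> C. satisfies \<omega> c}" for \<omega>
    define w where "w = real N ^ (M * s)"
    have w: "w > 0" using N by (simp add: w_def)
    have fin\<Omega>: "finite \<Omega>" and card\<Omega>: "real (card \<Omega>) = w"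
      by (simp_all add: \<Omega>_def w_def card_tuple_systems)
    have finC: "finite C"
      using double_points_bound two_cycles_bound three_cycles_bound by (simp add: C_def)

    have sum1: "(\<Sum>\<omega>\<in>\<Omega>. real (card {c \<in> double_points M s. satisfies \<omega> c})) \<le> q ^ 1 * w"
      unfolding \<Omega>_def w_def q_def M_def
    proof (rule sum_card_satisfies[OF _ _ N])
      show "finite (double_points (K * N) s)" using double_points_bound by blast
      have "real (card (double_points (K * N) s)) \<le> real (K * N * s\<^sup>2)"
        using double_points_bound of_nat_le_iff by blast
      then show "real (card (double_points (K * N) s)) \<le> (real K * real N * (real s)\<^sup>2) ^ 1" by simp
    qed (auto simp: double_points_def)
    have sum2: "(\<Sum>\<omega>\<in>\<Omega>. real (card {c \<in> two_cycles M s. satisfies \<omega> c})) \<le> q ^ 2 * w"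
      unfolding \<Omega>_def w_def q_def M_def
    proof (rule sum_card_satisfies[OF _ _ N])
      show "finite (two_cycles (K * N) s)" using two_cycles_bound by blast
      have "real (card (two_cycles (K * N) s)) \<le> real ((K * N * s\<^sup>2)\<^sup>2)"
        using two_cycles_bound of_nat_le_iff by blast
      then show "real (card (two_cycles (K * N) s)) \<le> (real K * real N * (real s)\<^sup>2)\<^sup>2" by simp
    qed (auto simp: two_cycles_def)
    have sum3: "(\<Sum>\<omega>\<in>\<Omega>. real (card {c \<in> three_cycles M s. satisfies \<omega> c})) \<le> q ^ 3 * w"
      unfolding \<Omega>_def w_def q_def M_def
    proof (rule sum_card_satisfies[OF _ _ N])
      show "finite (three_cycles (K * N) s)" using three_cycles_bound by blast
      have "real (card (three_cycles (K * N) s)) \<le> real ((K * N * s\<^sup>2) ^ 3)"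
        using three_cycles_bound of_nat_le_iff by blast
      then show "real (card (three_cycles (K * N) s)) \<le> (real K * real N * (real s)\<^sup>2) ^ 3" by simp
    qed (auto simp: three_cycles_def)
    have cardD: "real (card (D \<omega>)) \<le> real (card {c \<in> double_points M s. satisfies \<omega> c}) +
        real (card {c \<in> two_cycles M s. satisfies \<omega> c}) +
        real (card {c \<in> three_cycles M s. satisfies \<omega> c})" for \<omega>
    proof -
      have "card (D \<omega>) \<le> card {c \<in> C. satisfies \<omega> c}"
        unfolding D_def using finC by (intro card_image_le) simp
      also have "{c \<in> C. satisfies \<omega> c} = {c \<in> double_points M s. satisfies \<omega> c} \<union>
          {c \<in> two_cycles M s. satisfies \<omega> c} \<union> {c \<in> three_cycles M s. satisfies \<omega> c}"
        by (auto simp: C_def)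
      also have "card \<dots> \<le> card {c \<in> double_points M s. satisfies \<omega> c} +
          card {c \<in> two_cycles M s. satisfies \<omega> c} + card {c \<in> three_cycles M s. satisfies \<omega> c}"
        by (meson add_mono card_Un_le order_refl order_trans)
      finally show ?thesis by simp
    qed
    have "(\<Sum>\<omega>\<in>\<Omega>. real (card (D \<omega>))) \<le> (\<Sum>\<omega>\<in>\<Omega>. real (card {c \<in> double_points M s. satisfies \<omega> c}) +
        real (card {c \<in> two_cycles M s. satisfies \<omega> c}) +
        real (card {c \<in> three_cycles M s. satisfies \<omega> c}))"
      by (intro sum_mono cardD)
    also have "\<dots> \<le> T * w"
      using sum1 sum2 sum3 by (simp add: sum.distrib T_def algebra_simps)
    finally have sumD: "(\<Sum>\<omega>\<in>\<Omega>. real (card (D \<omega>))) \<le> T * w" .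

    define F where "F = {S. S \<subseteq> {..<N} \<and> real (card S) \<ge> \<delta> * real N}"
    define B where "B = (\<Union>S\<in>F. {\<omega> \<in> \<Omega>. \<forall>i<M. \<exists>a<s. \<omega> i a \<notin> S})"
    have FP: "F \<subseteq> Pow {..<N}" by (auto simp: F_def)
    then have finF: "finite F" by (rule finite_subset) simp
    have "card F \<le> 2 ^ N" using card_mono[OF _ FP] by (simp add: card_Pow)
    then have cardF: "real (card F) \<le> 2 ^ N"
      by (metis of_nat_le_iff of_nat_numeral of_nat_power)
    have "real (card {\<omega> \<in> \<Omega>. \<forall>i<M. \<exists>a<s. \<omega> i a \<notin> S}) \<le> w * (1 / 4) ^ N" if S: "S \<in> F" for S
    proof -
      have SN: "S \<subseteq> {..<N}" "real (card S) \<ge> \<delta> * real N" using S by (auto simp: F_def)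
      then have "card S \<le> N" by (metis card_lessThan card_mono finite_lessThan)
      then have Ss: "card S ^ s \<le> N ^ s" by (rule power_mono) simp
      have "(\<delta> * real N) ^ s \<le> real (card S) ^ s"
        using SN(2) assms(1) by (intro power_mono) auto
      then have le: "real (N ^ s - card S ^ s) \<le> real N ^ s * (1 - \<delta> ^ s)"
        using Ss by (simp add: of_nat_diff power_mult_distrib algebra_simps)
      have "real (card {\<omega> \<in> \<Omega>. \<forall>i<M. \<exists>a<s. \<omega> i a \<notin> S}) \<le> real ((N ^ s - card S ^ s) ^ M)"
        unfolding \<Omega>_def using card_missing_subset[OF SN(1)] of_nat_le_iff by blast
      also have "\<dots> \<le> (real N ^ s * (1 - \<delta> ^ s)) ^ M"
        unfolding of_nat_power by (rule power_mono[OF le]) simp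
      \<comment> \<open>The K N tuples are grouped into N blocks of K, each block giving a factor
        below 1/4.\<close>
      also have "\<dots> = w * ((1 - \<delta> ^ s) ^ K) ^ N"
        by (simp add: w_def M_def power_mult_distrib mult_ac flip: power_mult)
      also have "\<dots> \<le> w * (1 / 4) ^ N"
        using K d w by (intro mult_left_mono power_mono) auto
      finally show ?thesis .
    qed
    then have "(\<Sum>S\<in>F. real (card {\<omega> \<in> \<Omega>. \<forall>i<M. \<exists>a<s. \<omega> i a \<notin> S})) \<le> (\<Sum>S\<in>F. w * (1 / 4) ^ N)"
      by (rule sum_mono)
    moreover have "real (card B) \<le> (\<Sum>S\<in>F. real (card {\<omega> \<in> \<Omega>. \<forall>i<M. \<exists>a<s. \<omega> i a \<notin> S}))"
      unfolding B_def of_nat_sum[symmetric] of_nat_le_iff by (rule card_UN_le[OF finF])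
    ultimately have "real (card B) \<le> real (card F) * (w * (1 / 4) ^ N)" by simp
    also have "\<dots> \<le> 2 ^ N * (w * (1 / 4) ^ N)" using cardF w by (intro mult_right_mono) auto
    also have "\<dots> = w * (1 / 2) ^ N" by (simp add: mult.left_commute flip: power_mult_distrib)
    also have "\<dots> \<le> w * (1 / 2) ^ 1"
      using N w by (intro mult_left_mono power_decreasing) auto
    finally have cardB: "real (card B) \<le> w / 2" by simp
    have B\<Omega>: "B \<subseteq> \<Omega>" by (auto simp: B_def)
    then have "real (card (\<Omega> - B)) = w - real (card B)"
      using fin\<Omega> card\<Omega> by (metis card_Diff_subset card_mono finite_subset of_nat_diff)
    then have good: "real (card (\<Omega> - B)) \<ge> w / 2" using cardB by simp
    \<comment> \<open>Averaging: if |D| exceeded 2T throughout, these systems, at least w/2 in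
      number, would already contribute more than T w to the sum.\<close>
    have "\<exists>\<omega>\<in>\<Omega> - B. real (card (D \<omega>)) \<le> 2 * T"
    proof (rule ccontr)
      assume "\<not> (\<exists>\<omega>\<in>\<Omega> - B. real (card (D \<omega>)) \<le> 2 * T)"
      then have gt: "\<And>\<omega>. \<omega> \<in> \<Omega> - B \<Longrightarrow> 2 * T < real (card (D \<omega>))" by force
      have "card (\<Omega> - B) \<noteq> 0" using good w by (intro notI) simp
      then have "\<Omega> - B \<noteq> {}" by (metis card.empty)
      then have "(\<Sum>\<omega>\<in>\<Omega> - B. 2 * T) < (\<Sum>\<omega>\<in>\<Omega> - B. real (card (D \<omega>)))"
        using gt fin\<Omega> by (intro sum_strict_mono) auto
      also have "\<dots> \<le> (\<Sum>\<omega>\<in>\<Omega>. real (card (D \<omega>)))"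
        using fin\<Omega> by (intro sum_mono2) auto
      also have "\<dots> \<le> T * w" by (rule sumD)
      finally have "real (card (\<Omega> - B)) * (2 * T) < T * w" by simp
      moreover have "0 \<le> 2 * T" by (simp add: T_def q_def)
      then have "T * w \<le> real (card (\<Omega> - B)) * (2 * T)"
        using mult_right_mono[OF good, of "2 * T"] by (simp add: mult.commute)
      ultimately show False by linarith
    qed
    then obtain \<omega> where w': "\<omega> \<in> \<Omega>" "\<omega> \<notin> B" "real (card (D \<omega>)) \<le> 2 * T" by blast
    show "\<exists>M \<omega> D. (\<forall>i<M. \<forall>a<s. \<omega> i a < N) \<and> finite D \<and> real (card D) \<le> 2 * T \<and>
       (\<forall>c\<in>double_points M s \<union> two_cycles M s \<union> three_cycles M s.
          satisfies \<omega> c \<longrightarrow> case_prod \<omega> (fst (hd c)) \<in> D) \<and>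
       (\<forall>S\<subseteq>{..<N}. real (card S) \<ge> \<delta> * real N \<longrightarrow> (\<exists>i<M. \<forall>a<s. \<omega> i a \<in> S))"
    proof (intro exI[of _ M] exI[of _ \<omega>] exI[of _ "D \<omega>"] conjI)
      show "\<forall>i<M. \<forall>a<s. \<omega> i a < N"
        using w'(1) by (auto simp: \<Omega>_def tuple_systems_def PiE_iff)
      show "finite (D \<omega>)" using finC by (simp add: D_def)
      show "\<forall>c\<in>double_points M s \<union> two_cycles M s \<union> three_cycles M s.
          satisfies \<omega> c \<longrightarrow> case_prod \<omega> (fst (hd c)) \<in> D \<omega>"
        unfolding C_def[symmetric] D_def by blast
      show "\<forall>S\<subseteq>{..<N}. real (card S) \<ge> \<delta> * real N \<longrightarrow> (\<exists>i<M. \<forall>a<s. \<omega> i a \<in> S)"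
        using w'(1,2) unfolding B_def F_def by blast
    qed (rule w'(3))
  qed
qed

text \<open>As \<open>\<delta>\<close> is arbitrary, this is the o(N) bound. Tuples that avoid
  \<open>D\<close> become cliques: every K_s-free set then has fewer than \<delta> N vertices
  outside \<open>D\<close>, and every clique lies in a single tuple.\<close>

lemma erdos_rogers_sublinear:
  fixes \<delta> :: real
  assumes "0 < \<delta>" "\<delta> \<le> 1" "s \<ge> 2"
  shows "\<exists>T::real. \<forall>N\<ge>1. real (erdos_rogers s (s + 1) N) \<le> \<delta> * real N + T"
proof -
  have s1: "s \<ge> 1" using assms(3) by simp
  obtain T :: real where T: "\<forall>N\<ge>1. \<exists>M \<omega> D. (\<forall>i<M. \<forall>a<s. \<omega> i a < N) \<and>
     finite D \<and> real (card D) \<le> T \<and>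
     (\<forall>c\<in>double_points M s \<union> two_cycles M s \<union> three_cycles M s.
        satisfies \<omega> c \<longrightarrow> case_prod \<omega> (fst (hd c)) \<in> D) \<and>
     (\<forall>S\<subseteq>{..<N}. real (card S) \<ge> \<delta> * real N \<longrightarrow> (\<exists>i<M. \<forall>a<s. \<omega> i a \<in> S))"
    using sparse_tuple_system_exists[OF assms(1,2) s1] by (elim exE)
  have "real (erdos_rogers s (s + 1) N) \<le> \<delta> * real N + (T + 1)" if N: "N \<ge> 1" for N
  proof -
    obtain M \<omega> D where MwD: "(\<forall>i<M. \<forall>a<s. \<omega> i a < N) \<and> finite D \<and> real (card D) \<le> T \<and>
       (\<forall>c\<in>double_points M s \<union> two_cycles M s \<union> three_cycles M s.
          satisfies \<omega> c \<longrightarrow> case_prod \<omega> (fst (hd c)) \<in> D) \<and>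
       (\<forall>S\<subseteq>{..<N}. real (card S) \<ge> \<delta> * real N \<longrightarrow> (\<exists>i<M. \<forall>a<s. \<omega> i a \<in> S))"
      using T[rule_format, OF N] by (elim exE)
    then have \<omega>: "\<And>i a. i < M \<Longrightarrow> a < s \<Longrightarrow> \<omega> i a < N"
      and D: "finite D" "real (card D) \<le> T"
      and bad: "\<And>c. c \<in> double_points M s \<union> two_cycles M s \<union> three_cycles M s \<Longrightarrow>
        satisfies \<omega> c \<Longrightarrow> case_prod \<omega> (fst (hd c)) \<in> D"
      and hit: "\<And>S. S \<subseteq> {..<N} \<Longrightarrow> real (card S) \<ge> \<delta> * real N \<Longrightarrow> \<exists>i<M. \<forall>a<s. \<omega> i a \<in> S"
      by blast+
    have bad1: "\<omega> i a \<in> D" if "i < M" "a < s" "b < s" "a \<noteq> b" "\<omega> i a = \<omega> i b" for i a b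
    proof -
      have "[((i, a), (i, b))] \<in> double_points M s"
        unfolding double_points_def by (rule image_eqI[where x = "(i, a, b)"]) (use that in auto)
      then show ?thesis using bad that(5) by (fastforce simp: satisfies_def)
    qed
    have bad2: "\<omega> i a \<in> D"
      if "i < M" "j < M" "i \<noteq> j" "a < s" "b < s" "a' < s" "b' < s" "a \<noteq> a'"
        "\<omega> i a = \<omega> j b" "\<omega> i a' = \<omega> j b'" for i j a b a' b'
    proof -
      have "[((i, a), (j, b)), ((i, a'), (j, b'))] \<in> two_cycles M s"
        unfolding two_cycles_def
        by (rule image_eqI[where x = "(i, j, a, b, a', b')"]) (use that in auto)
      then show ?thesis using bad that(9,10) by (fastforce simp: satisfies_def)
    qed
    have bad3: "\<omega> i a \<in> D"
      if "i < M" "j < M" "l < M" "i \<noteq> j" "j \<noteq> l" "l \<noteq> i"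
        "a < s" "b < s" "b' < s" "c < s" "c' < s" "a' < s" "a \<noteq> a'" "b \<noteq> b'" "c \<noteq> c'"
        "\<omega> i a = \<omega> j b" "\<omega> j b' = \<omega> l c" "\<omega> l c' = \<omega> i a'" for i j l a b b' c c' a'
    proof -
      have "[((i, a), (j, b)), ((j, b'), (l, c)), ((l, c'), (i, a'))] \<in> three_cycles M s"
        unfolding three_cycles_def
        by (rule image_eqI[where x = "(i, j, l, a, b, b', c, c', a')"]) (use that in auto)
      then show ?thesis using bad that(16-18) by (fastforce simp: satisfies_def)
    qed
    \<comment> \<open>Only the tuples in \<open>I\<close> carry edges, so the vertices of
      \<open>D\<close> become isolated.\<close>
    define e where "e i = \<omega> i ` {..<s}" for i
    define I where "I = {i. i < M \<and> e i \<inter> D = {}}"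
    define E where "E = {{u, v} |u v i. u \<noteq> v \<and> i \<in> I \<and> u \<in> e i \<and> v \<in> e i}"
    have point: "\<exists>a<s. u = \<omega> i a" if "u \<in> e i" for i u using that by (auto simp: e_def)
    have edge: "\<exists>i\<in>I. u \<in> e i \<and> v \<in> e i" if "{u, v} \<in> E" for u v
      using that by (auto simp: E_def doubleton_eq_iff)
    \<comment> \<open>A second common vertex of two surviving tuples would complete a two-cycle and
      put \<open>u\<close> into \<open>D\<close>.\<close>
    have linear: "i = j" if h: "i \<in> I" "j \<in> I" "u \<noteq> v" "u \<in> e i" "v \<in> e i" "u \<in> e j" "v \<in> e j" for i j u v
    proof (rule ccontr)
      assume "i \<noteq> j"
      obtain a a' b b' where "a < s" "a' < s" "b < s" "b' < s"
        "u = \<omega> i a" "v = \<omega> i a'" "u = \<omega> j b" "v = \<omega> j b'"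
        using point[OF h(4)] point[OF h(5)] point[OF h(6)] point[OF h(7)] by blast
      then have "u \<in> D" using bad2[of i j a b a' b'] h \<open>i \<noteq> j\<close> by (auto simp: I_def)
      then show False using h by (auto simp: I_def)
    qed
    \<comment> \<open>Such tuples form a three-cycle whose marked vertex is \<open>u\<close>;
      distinctness of u, v, x makes the two positions in each tuple differ.\<close>
    have no_triangle: False if h: "i \<in> I" "j \<in> I" "l \<in> I" "i \<noteq> j" "j \<noteq> l" "l \<noteq> i"
      "u \<noteq> v" "v \<noteq> x" "x \<noteq> u" "u \<in> e i" "u \<in> e j" "x \<in> e j" "x \<in> e l" "v \<in> e l" "v \<in> e i"
      for i j l u v x
    proof -
      obtain a a' b b' c c' where "a < s" "a' < s" "b < s" "b' < s" "c < s" "c' < s"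
        "u = \<omega> i a" "u = \<omega> j b" "x = \<omega> j b'" "x = \<omega> l c" "v = \<omega> l c'" "v = \<omega> i a'"
        using point[OF h(10)] point[OF h(11)] point[OF h(12)] point[OF h(13)]
          point[OF h(14)] point[OF h(15)] by blast
      moreover from this h(7-9) have "a \<noteq> a'" "b \<noteq> b'" "c \<noteq> c'" by auto
      moreover have "i < M" "j < M" "l < M" using h(1-3) by (auto simp: I_def)
      ultimately have "u \<in> D" using bad3[of i j l a b b' c c' a'] h(4-6) by simp
      then show False using h by (auto simp: I_def)
    qed
    let ?G = "({..<N}, E)"
    have G: "fin_simple_graph ?G"
      using \<omega> by (auto simp: fin_simple_graph_def E_def I_def e_def)
    have "clique_free (s + 1) E {..<N}"
      unfolding clique_free_def
    proof clarify
      fix Q assume Q: "finite Q" "card Q = s + 1" "clique Q E"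
      then have "\<not> card Q \<le> Suc 0" using assms(3) by simp
      then obtain u v where uv: "u \<in> Q" "v \<in> Q" "u \<noteq> v"
        using Q(1) by (auto simp: card_le_Suc0_iff_eq)
      then obtain i where i: "i \<in> I" "u \<in> e i" "v \<in> e i"
        using edge Q(3) by (meson clique_def)
      \<comment> \<open>A clique vertex x outside \<open>e i\<close> is joined to u and v through
        tuples j and l. If j = l, that tuple shares u and v with i, against \<open>linear\<close>;
        otherwise i, j, l form a forbidden triangle.\<close>
      have "Q \<subseteq> e i"
      proof
        fix x assume x: "x \<in> Q"
        show "x \<in> e i"
        proof (rule ccontr)
          assume nx: "x \<notin> e i"
          then have ne: "x \<noteq> u" "v \<noteq> x" using i by auto
          obtain j where j: "j \<in> I" "u \<in> e j" "x \<in> e j"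
            using edge[of u x] Q(3) uv(1) x ne(1) by (auto simp: clique_def)
          obtain l where l: "l \<in> I" "x \<in> e l" "v \<in> e l"
            using edge[of x v] Q(3) uv(2) x ne(2) by (auto simp: clique_def)
          have "i \<noteq> j" "l \<noteq> i" using nx j l by auto
          moreover have "j \<noteq> l" using linear[OF i(1) j(1) uv(3)] i j l nx by auto
          ultimately show False
            using no_triangle[of i j l u v x] i j l uv(3) ne by blast
        qed
      qed
      then have "card Q \<le> card (e i)" by (intro card_mono) (simp_all add: e_def)
      also have "\<dots> \<le> s" using card_image_le[of "{..<s}" "\<omega> i"] by (simp add: e_def)
      finally show False using Q(2) by simp
    qed
    then have "erdos_rogers s (s + 1) N \<le> indep_num s ?G"
      using G assms(3) by (intro erdos_rogers_le) auto
    also have "\<dots> \<le> nat \<lfloor>\<delta> * real N + T\<rfloor> + 1"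
    proof (rule indep_num_le[OF G])
      fix S assume S: "S \<subseteq> verts ?G" "clique_free s (edges ?G) S"
      have finS: "finite S" using S(1) by (auto intro: finite_subset)
      \<comment> \<open>Otherwise some tuple lies inside \<open>S - D\<close>; it avoids
        \<open>D\<close>, hence survives and spans a clique within \<open>S\<close>.\<close>
      have "real (card (S - D)) < \<delta> * real N"
      proof (rule ccontr)
        assume "\<not> real (card (S - D)) < \<delta> * real N"
        then obtain i where i: "i < M" "\<And>a. a < s \<Longrightarrow> \<omega> i a \<in> S - D"
          using hit[of "S - D"] S(1) by auto
        then have iI: "i \<in> I" by (auto simp: I_def e_def)
        \<comment> \<open>A repeated entry would be a double point and lie in \<open>D\<close>; so
          the clique really has s vertices.\<close>
        have "inj_on (\<omega> i) {..<s}"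
        proof (rule inj_onI, rule ccontr)
          fix a b assume "a \<in> {..<s}" "b \<in> {..<s}" "\<omega> i a = \<omega> i b" "a \<noteq> b"
          then show False using bad1[of i a b] i by auto
        qed
        then have "card (e i) = s" by (simp add: e_def card_image)
        moreover have "clique (e i) E" using iI by (auto simp: clique_def E_def)
        moreover have "e i \<subseteq> S" using i by (auto simp: e_def)
        ultimately show False
          using S(2) finS unfolding clique_free_def by (simp add: finite_subset)
      qed
      moreover have "card S \<le> card (S - D) + card D"
        using card_Un_le[of "S - D" D] card_mono[of "S - D \<union> D" S] finS D(1) by auto
      ultimately have "real (card S) \<le> \<delta> * real N + T" using D(2) by linarith
      then show "card S \<le> nat \<lfloor>\<delta> * real N + T\<rfloor> + 1" by linarith
    qed (use assms in auto)
    finally have "real (erdos_rogers s (s + 1) N) \<le> real (nat \<lfloor>\<delta> * real N + T\<rfloor>) + 1" by linarith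
    \<comment> \<open>\<open>nat\<close> truncates negative values; here \<open>T\<close> is
      nonnegative because it bounds |D|.\<close>
    moreover have "0 \<le> \<delta> * real N + T" using assms(1) D(2) by (simp add: order_trans[of 0 "real (card D)"])
    ultimately show ?thesis by linarith
  qed
  then show ?thesis by blast
qed

section \<open>The join of copies of a graph\<close>

lemma card_residue_class_le:
  assumes "k \<ge> 1"
  shows "real (card {u. u < n \<and> u mod k = p}) \<le> real n / real k + 1"
proof -
  have "inj_on (\<lambda>u. u div k) {u. u < n \<and> u mod k = p}"
    by (rule inj_onI) (metis (mono_tags, lifting) div_mult_mod_eq mem_Collect_eq)
  moreover have "(\<lambda>u. u div k) ` {u. u < n \<and> u mod k = p} \<subseteq> {..n div k}"
    by (auto intro: div_le_mono)
  ultimately have "card {u. u < n \<and> u mod k = p} \<le> card {..n div k}"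
    by (rule card_inj_on_le) simp
  then have "real (card {u. u < n \<and> u mod k = p}) \<le> real (n div k) + 1" by simp
  also have "\<dots> \<le> real n / real k + 1"
    using assms of_nat_mono[OF div_times_less_eq_dividend[of n k], where ?'a = real]
    by (simp add: pos_le_divide_eq)
  finally show ?thesis .
qed

text \<open>Parts are the residue classes mod \<open>k\<close>, and the vertices of each part are numbered by
  their quotient: quotients below \<open>m\<close> form a copy of \<open>F\<close>, a vertex of quotient \<open>m\<close> is isolated in
  its part.\<close>

definition join_of_copies :: "nat \<Rightarrow> nat \<Rightarrow> nat \<Rightarrow> (nat \<Rightarrow> 'a) \<Rightarrow> 'a set set \<Rightarrow> nat set set" where
  "join_of_copies n k m \<phi> F = {{u, v} |u v. u < n \<and> v < n \<and> (u mod k = v mod k \<longrightarrow>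
     u div k < m \<and> v div k < m \<and> {\<phi> (u div k), \<phi> (v div k)} \<in> F)}"

lemma join_of_copies_iff:
  "{u, v} \<in> join_of_copies n k m \<phi> F \<longleftrightarrow> u < n \<and> v < n \<and> (u mod k = v mod k \<longrightarrow>
     u div k < m \<and> v div k < m \<and> {\<phi> (u div k), \<phi> (v div k)} \<in> F)"
  unfolding join_of_copies_def by (auto simp: doubleton_eq_iff insert_commute)

context
  fixes n k m s :: nat and \<phi> :: "nat \<Rightarrow> 'a" and F :: "'a sgraph" and E :: "nat set set"
  assumes k: "k \<ge> 1" and s: "s \<ge> 2" and F: "fin_simple_graph F"
    and \<phi>: "bij_betw \<phi> {..<m} (verts F)" and n: "n \<le> k * (m + 1)"
  defines "E \<equiv> join_of_copies n k m \<phi> (edges F)"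
begin

lemma fin_simple_graph_join: "fin_simple_graph ({..<n}, E)"
proof -
  have "edges F \<subseteq> nsets (verts F) 2" using F by (simp add: fin_simple_graph_def)
  moreover have "{x} \<notin> nsets (verts F) 2" for x by (simp add: nsets_def)
  ultimately have "{x} \<notin> edges F" for x by blast
  then show ?thesis
    by (auto simp: fin_simple_graph_def E_def join_of_copies_def)
qed

text \<open>This is where n \<le> k(m + 1) enters: each part has at most one vertex outside its copy
  of \<open>F\<close>.\<close>

lemma quotient_le: "u < n \<Longrightarrow> u div k \<le> m"
  using less_mult_imp_div_less[of u "m + 1" k] n by (simp add: mult.commute)

lemma inj_on_part: "inj_on (\<lambda>u. \<phi> (u div k)) {u. u < n \<and> u mod k = p \<and> u div k < m}"
proof (rule inj_onI)
  fix u v assume uv: "u \<in> {u. u < n \<and> u mod k = p \<and> u div k < m}"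
    "v \<in> {u. u < n \<and> u mod k = p \<and> u div k < m}" "\<phi> (u div k) = \<phi> (v div k)"
  then have "u div k = v div k" using \<phi> by (auto simp: bij_betw_def inj_on_def)
  with uv show "u = v" by (metis (mono_tags, lifting) div_mult_mod_eq mem_Collect_eq)
qed

text \<open>A vertex outside the copy has no neighbour in its own part, so it would be alone there;
  otherwise the part of the clique is mapped injectively onto a clique of \<open>F\<close>.\<close>

lemma card_clique_part:
  assumes cf: "clique_free (s + 1) (edges F) (verts F)" and Q: "Q \<subseteq> {..<n}" "clique Q E"
  shows "card {u \<in> Q. u mod k = p} \<le> s"
proof (cases "\<exists>x\<in>Q. x mod k = p \<and> \<not> x div k < m")
  case True
  then obtain x where x: "x \<in> Q" "x mod k = p" "\<not> x div k < m" by blast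
  have "{u \<in> Q. u mod k = p} \<subseteq> {x}"
    using Q(2) x by (auto simp: clique_def E_def join_of_copies_iff)
  then have "card {u \<in> Q. u mod k = p} \<le> card {x}" by (intro card_mono) auto
  then show ?thesis using s by simp
next
  case False
  let ?A = "{u \<in> Q. u mod k = p}"
  let ?\<psi> = "\<lambda>u. \<phi> (u div k)"
  have "finite Q" using Q(1) finite_subset by blast
  moreover have "inj_on ?\<psi> ?A"
    by (rule inj_on_subset[OF inj_on_part[of p]]) (use Q(1) False in auto)
  moreover have "clique (?\<psi> ` ?A) (edges F)"
    unfolding clique_def
  proof (intro ballI impI)
    fix v w assume "v \<in> ?\<psi> ` ?A" "w \<in> ?\<psi> ` ?A" "v \<noteq> w"
    then obtain x y where "x \<in> ?A" "y \<in> ?A" "x \<noteq> y" "v = ?\<psi> x" "w = ?\<psi> y" by auto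
    moreover from this have "{x, y} \<in> E" using Q(2) by (auto simp: clique_def)
    ultimately show "{v, w} \<in> edges F" by (auto simp: E_def join_of_copies_iff)
  qed
  moreover have "?\<psi> ` ?A \<subseteq> verts F" using False \<phi> by (auto simp: bij_betw_def)
  ultimately have "card (?\<psi> ` ?A) < s + 1" "card (?\<psi> ` ?A) = card ?A"
    using clique_card_less[OF cf, of "?\<psi> ` ?A"] by (auto simp: card_image)
  then show ?thesis by simp
qed

lemma card_split_residues:
  assumes "finite A"
  shows "card A = (\<Sum>p<k. card {u \<in> A. u mod k = p})"
proof -
  have "(\<lambda>u. u mod k) ` A \<subseteq> {..<k}" using k by auto
  then show ?thesis
    using sum.group[of A "{..<k}" "\<lambda>u. u mod k" "\<lambda>_. 1::nat"] assms by simp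
qed

lemma clique_free_join:
  assumes "clique_free (s + 1) (edges F) (verts F)"
  shows "clique_free (k * s + 1) E {..<n}"
  unfolding clique_free_def
proof clarify
  fix Q assume Q: "Q \<subseteq> {..<n}" "finite Q" "card Q = k * s + 1" "clique Q E"
  have "card Q = (\<Sum>p<k. card {u \<in> Q. u mod k = p})" by (rule card_split_residues[OF Q(2)])
  also have "\<dots> \<le> (\<Sum>p<k. s)" by (intro sum_mono card_clique_part[OF assms Q(1,4)])
  finally show False using Q(3) by simp
qed

text \<open>Cliques of \<open>F\<close> pull back to the part, so the vertices inside the copy give
  a K_s-free set of \<open>F\<close>; the added 1 is the possible isolated vertex.\<close>

lemma card_clique_free_part:
  assumes S: "S \<subseteq> {..<n}" "clique_free s E S"
  shows "card {u \<in> S. u mod k = p} \<le> indep_num s F + 1"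
proof -
  let ?\<psi> = "\<lambda>u. \<phi> (u div k)"
  let ?A = "{u \<in> S. u mod k = p \<and> u div k < m}"
  have finS: "finite S" using S(1) finite_subset by blast
  have inj: "inj_on ?\<psi> ?A"
    by (rule inj_on_subset[OF inj_on_part[of p]]) (use S(1) in auto)
  have "clique_free s (edges F) (?\<psi> ` ?A)"
    unfolding clique_free_def
  proof clarify
    fix K assume K: "K \<subseteq> ?\<psi> ` ?A" "finite K" "s = card K" "clique K (edges F)"
    then obtain R where R: "R \<subseteq> ?A" "K = ?\<psi> ` R" by (meson subset_imageE)
    have injR: "inj_on ?\<psi> R" using inj R(1) inj_on_subset by blast
    have "clique R E"
      unfolding clique_def
    proof (intro ballI impI)
      fix u v assume uv: "u \<in> R" "v \<in> R" "u \<noteq> v"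
      then have "?\<psi> u \<noteq> ?\<psi> v" using injR by (auto dest: inj_onD)
      then have "{?\<psi> u, ?\<psi> v} \<in> edges F" using K(4) R(2) uv by (simp add: clique_def)
      then show "{u, v} \<in> E" using uv R(1) S(1) by (auto simp: E_def join_of_copies_iff)
    qed
    moreover have "card R = s" using injR K(3) R(2) by (simp add: card_image)
    moreover have "R \<subseteq> S" using R(1) by blast
    ultimately show False
      using clique_card_less[OF S(2), of R] finS finite_subset by blast
  qed
  moreover have "?\<psi> ` ?A \<subseteq> verts F" using \<phi> by (auto simp: bij_betw_def)
  ultimately have "card (?\<psi> ` ?A) \<le> indep_num s F"
    using s by (intro card_le_indep_num[OF F]) auto
  then have A: "card ?A \<le> indep_num s F" using inj by (simp add: card_image)
  \<comment> \<open>The vertex of quotient m and residue p is m k + p.\<close>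
  have "{u \<in> S. u mod k = p} \<subseteq> insert (m * k + p) ?A"
  proof
    fix u assume u: "u \<in> {u \<in> S. u mod k = p}"
    show "u \<in> insert (m * k + p) ?A"
    proof (cases "u div k < m")
      case False
      then have "u div k = m" using quotient_le[of u] u S(1) by auto
      then show ?thesis using u by (metis (mono_tags, lifting) div_mult_mod_eq insert_iff mem_Collect_eq)
    qed (use u in simp)
  qed
  then have "card {u \<in> S. u mod k = p} \<le> card (insert (m * k + p) ?A)"
    using finS by (intro card_mono) auto
  also have "\<dots> \<le> card ?A + 1" using card_insert_le_m1 finS by (simp add: card_insert_if)
  finally show ?thesis using A by simp
qed

text \<open>Vertices of different parts are adjacent, so for s = 2 the set lies in one part; for
  larger s the bounds of all k parts are added.\<close>

lemma indep_num_join_le: "indep_num s ({..<n}, E) \<le> (if s = 2 then 1 else k) * (indep_num s F + 1)"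
proof (rule indep_num_le[OF fin_simple_graph_join])
  fix S assume "S \<subseteq> verts ({..<n}, E)" "clique_free s (edges ({..<n}, E)) S"
  then have S: "S \<subseteq> {..<n}" "clique_free s E S" by simp_all
  then have finS: "finite S" using finite_subset by blast
  show "card S \<le> (if s = 2 then 1 else k) * (indep_num s F + 1)"
  proof (cases "s = 2 \<and> S \<noteq> {}")
    case True
    then obtain x where x: "x \<in> S" by blast
    have "u mod k = x mod k" if u: "u \<in> S" for u
    proof (rule ccontr)
      assume ne: "u mod k \<noteq> x mod k"
      then have "u \<noteq> x" by auto
      moreover have "{u, x} \<in> E" "{x, u} \<in> E"
        using ne u x S(1) by (auto simp: E_def join_of_copies_iff)
      ultimately have "card {u, x} = 2" "clique {u, x} E" by (auto simp: clique_def)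
      then show False
        using clique_card_less[OF S(2), of "{u, x}"] u x True by simp
    qed
    then have "S = {u \<in> S. u mod k = x mod k}" by blast
    then have "card S \<le> indep_num s F + 1"
      using card_clique_free_part[OF S, of "x mod k"] by simp
    then show ?thesis using True by simp
  next
    case False
    show ?thesis
    proof (cases "s = 2")
      case True
      then show ?thesis using False by simp
    next
      case s2: False
      have "card S = (\<Sum>p<k. card {u \<in> S. u mod k = p})" by (rule card_split_residues[OF finS])
      also have "\<dots> \<le> (\<Sum>p<k. indep_num s F + 1)" by (intro sum_mono card_clique_free_part[OF S])
      finally show ?thesis using s2 by simp
    qed
  qed
qed (use s in simp)

text \<open>Every non-edge lies inside a part. The parts are nearly equal, so there are at most
  n^2/(2k) non-edges, to be subtracted from all n(n - 1)/2 pairs.\<close>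

lemma card_join_ge: "real (card E) \<ge> 1 / 2 * (1 - 1 / real k) * (real n)\<^sup>2 - real n / 2"
proof -
  let ?P = "\<lambda>p. {u. u < n \<and> u mod k = p}"
  have fin: "finite (nsets {..<n} 2)" by (simp add: finite_imp_finite_nsets)
  have EN: "E \<subseteq> nsets {..<n} 2" using fin_simple_graph_join by (simp add: fin_simple_graph_def)
  have "nsets {..<n} 2 - E \<subseteq> (\<Union>p<k. nsets (?P p) 2)"
  proof
    fix e assume e: "e \<in> nsets {..<n} 2 - E"
    then have "e \<in> nsets {..<n} 2" by blast
    then obtain u v where uv: "e = {u, v}" "u < n" "v < n" "u \<noteq> v"
      by (auto elim!: nsets2_E)
    then have "u mod k = v mod k" using e by (auto simp: E_def join_of_copies_iff)
    then have "e \<in> nsets (?P (u mod k)) 2" using uv by simp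
    moreover have "u mod k < k" using k by simp
    ultimately show "e \<in> (\<Union>p<k. nsets (?P p) 2)" by blast
  qed
  then have "card (nsets {..<n} 2 - E) \<le> card (\<Union>p<k. nsets (?P p) 2)"
    by (intro card_mono) (auto simp: finite_imp_finite_nsets)
  also have "\<dots> \<le> (\<Sum>p<k. card (nsets (?P p) 2))" by (intro card_UN_le) simp
  finally have "real (card (nsets {..<n} 2 - E)) \<le> (\<Sum>p<k. real (card (?P p) choose 2))"
    by (simp add: card_nsets flip: of_nat_sum)
  also have "\<dots> \<le> (\<Sum>p<k. real (card (?P p)) * (real n / real k) / 2)"
  proof (rule sum_mono)
    fix p assume "p \<in> {..<k}"
    \<comment> \<open>A part has at most n/k + 1 vertices; the excess 1 is cancelled by the -1 in
      the binomial coefficient.\<close>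
    have "real (card (?P p)) * (real (card (?P p)) - 1) \<le> real (card (?P p)) * (real n / real k)"
      using card_residue_class_le[OF k, of n p] by (intro mult_left_mono) auto
    then show "real (card (?P p) choose 2) \<le> real (card (?P p)) * (real n / real k) / 2"
      by (simp add: real_choose_two)
  qed
  also have "\<dots> = real (\<Sum>p<k. card {u \<in> {..<n}. u mod k = p}) * (real n / real k) / 2"
    by (simp add: sum_distrib_right sum_divide_distrib)
  also have "\<dots> = real n * (real n / real k) / 2"
    using card_split_residues[of "{..<n}"] by simp
  finally have le: "real (card (nsets {..<n} 2 - E)) \<le> real n * (real n / real k) / 2" .
  have "real (card (nsets {..<n} 2 - E)) = real (n choose 2) - real (card E)"
    using EN fin card_mono[OF fin EN]
    by (simp add: card_Diff_subset finite_subset card_nsets of_nat_diff)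
  moreover have "1 / 2 * (1 - 1 / real k) * (real n)\<^sup>2 - real n / 2
      = real (n choose 2) - real n * (real n / real k) / 2"
    by (simp add: real_choose_two power2_eq_square algebra_simps diff_divide_distrib)
  ultimately show ?thesis using le by linarith
qed

end

section \<open>Bounds for the Ramsey-Turan number\<close>

lemma card_edges_le_RT: "G \<in> RT_graphs s n H x \<Longrightarrow> card (edges G) \<le> RT s n H x"
  using finite_RT_graphs_edges[of s n H x] by (auto simp: RT_def)

text \<open>A nonzero value cannot be the default 0 of an empty family, so it is a genuine
  maximum.\<close>

lemma RT_attained:
  assumes "RT s n H x \<noteq> 0"
  obtains G where "G \<in> RT_graphs s n H x" "card (edges G) = RT s n H x"
proof -
  have ne: "RT_graphs s n H x \<noteq> {}" using assms by (auto simp: RT_def)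
  then have "RT s n H x = Max ((\<lambda>G. card (edges G)) ` RT_graphs s n H x)" by (simp add: RT_def)
  also have "\<dots> \<in> (\<lambda>G. card (edges G)) ` RT_graphs s n H x"
    using ne by (intro Max_in finite_RT_graphs_edges) simp
  finally show thesis using that by (metis (no_types, lifting) imageE)
qed

lemma RT_lower_bound:
  assumes "k \<ge> 1" "s \<ge> 2" "r \<ge> 1" "n \<le> k * (m + 1)"
    and x: "real ((if s = 2 then 1 else k) * (erdos_rogers s (s + 1) m + 1)) < x"
  shows "1 / 2 * (1 - 1 / real k) * (real n)\<^sup>2 - real n / 2
    \<le> real (RT s n (complete_graph (k * s + r)) x)"
proof -
  obtain F :: "nat sgraph" where F: "fin_simple_graph F" "card (verts F) = m"
    "clique_free (s + 1) (edges F) (verts F)" "indep_num s F = erdos_rogers s (s + 1) m"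
    by (rule erdos_rogers_attained[of s "s + 1" m]) (use assms in auto)
  have "finite (verts F)" using F(1) by (simp add: fin_simple_graph_def)
  then obtain \<phi> where \<phi>: "bij_betw \<phi> {..<m} (verts F)"
    using ex_bij_betw_nat_finite F(2) by (metis atLeast0LessThan)
  define E where "E = join_of_copies n k m \<phi> (edges F)"
  note join = assms(1,2) F(1) \<phi> assms(4)
  \<comment> \<open>The join is already K_{ks+1}-free, and r \<ge> 1.\<close>
  have "clique_free (k * s + r) E {..<n}"
    unfolding E_def
    by (rule clique_free_mono[OF clique_free_join[OF join F(3)]]) (use assms(3) in simp)
  moreover have "indep_num s ({..<n}, E) \<le> (if s = 2 then 1 else k) * (erdos_rogers s (s + 1) m + 1)"
    using indep_num_join_le[OF join] unfolding E_def F(4) .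
  then have "real (indep_num s ({..<n}, E)) < x" using x of_nat_mono order_le_less_trans by blast
  ultimately have "({..<n}, E) \<in> RT_graphs s n (complete_graph (k * s + r)) x"
    using fin_simple_graph_join[OF join] by (simp add: RT_graphs_def free_of_complete_graph E_def)
  then have "card E \<le> RT s n (complete_graph (k * s + r)) x"
    using card_edges_le_RT by fastforce
  moreover have "1 / 2 * (1 - 1 / real k) * (real n)\<^sup>2 - real n / 2 \<le> real (card E)"
    using card_join_ge[OF join] by (simp add: E_def)
  ultimately show ?thesis by linarith
qed

lemma RT_upper_bound:
  fixes \<epsilon> x :: real
  assumes "k \<ge> 1" "s \<ge> 1" "0 < \<epsilon>" "\<epsilon> \<le> 1" and x: "2 ^ (k * s) * x \<le> \<epsilon>\<^sup>2 * real n - 1"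
  shows "real (RT s n (complete_graph (k * s + 1)) x)
    \<le> 1 / 2 * (1 - 1 / real k) * (real n)\<^sup>2 + \<epsilon> * (real n)\<^sup>2"
proof (rule ccontr)
  let ?R = "RT s n (complete_graph (k * s + 1)) x"
  assume "\<not> ?thesis"
  then have gt: "1 / 2 * (1 - 1 / real k) * (real n)\<^sup>2 + \<epsilon> * (real n)\<^sup>2 < real ?R" by simp
  \<comment> \<open>Exceeding a nonnegative bound rules out the default value, so an extremal graph
    exists; it would have too large an s-independence number.\<close>
  have "0 \<le> 1 / 2 * (1 - 1 / real k) * (real n)\<^sup>2 + \<epsilon> * (real n)\<^sup>2"
    using assms(1,3) by simp
  with gt have "?R \<noteq> 0" by linarith
  then obtain G where G: "G \<in> RT_graphs s n (complete_graph (k * s + 1)) x" "card (edges G) = ?R"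
    by (rule RT_attained)
  then have G': "fin_simple_graph G" "card (verts G) = n" "real (indep_num s G) < x"
    "clique_free (k * s + 1) (edges G) (verts G)"
    by (auto simp: RT_graphs_def free_of_complete_graph)
  have "\<epsilon>\<^sup>2 * real n - 1 \<le> 2 ^ (k * s) * real (indep_num s G)"
    using indep_num_large_if_dense[OF G'(1) assms(1-4) G'(4)] gt G(2) G'(2) by simp
  also have "\<dots> < 2 ^ (k * s) * x" using G'(3) by simp
  finally show False using x by simp
qed

text \<open>The asymptotic claims in \<epsilon>-form. Floor and ceiling are treated alike through
  n/k - 1 \<le> m \<le> n/k + 1.\<close>

lemma eventually_RT_bounds:
  fixes k s r :: nat and c :: real and m :: "nat \<Rightarrow> nat"
  assumes "k \<ge> 2" "s \<ge> 2"
    and c: "s = 2 \<Longrightarrow> c > 1" "s \<ge> 3 \<Longrightarrow> c > real k"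
    and rounding: "\<And>n. int (m n) = \<lfloor>real n / real k\<rfloor> \<or> int (m n) = \<lceil>real n / real k\<rceil>"
  defines "f \<equiv> (\<lambda>n. 1 / 2 * (1 - 1 / real k) * (real n)\<^sup>2)"
  shows "r \<ge> 1 \<Longrightarrow> \<epsilon> > 0 \<Longrightarrow> \<forall>\<^sub>F n in sequentially.
      f n - \<epsilon> * (real n)\<^sup>2
        \<le> real (RT s n (complete_graph (k * s + r)) (c * real (erdos_rogers s (s + 1) (m n))))"
    and "\<epsilon> > 0 \<Longrightarrow> \<forall>\<^sub>F n in sequentially.
      real (RT s n (complete_graph (k * s + 1)) (c * real (erdos_rogers s (s + 1) (m n))))
        \<le> f n + \<epsilon> * (real n)\<^sup>2"
proof -
  have k0: "real k > 0" using assms(1) by simp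
  have m: "real n / real k - 1 \<le> real (m n)" "real (m n) \<le> real n / real k + 1" "n \<le> k * (m n + 1)" for n
  proof -
    have "real (m n) = real_of_int \<lfloor>real n / real k\<rfloor> \<or> real (m n) = real_of_int \<lceil>real n / real k\<rceil>"
      using rounding[of n] by (metis of_int_of_nat_eq)
    then show 1: "real n / real k - 1 \<le> real (m n)" "real (m n) \<le> real n / real k + 1" by linarith+
    from 1(1) have "real n / real k \<le> real (m n + 1)" by simp
    then have "real n \<le> real (k * (m n + 1))" using k0 by (simp add: pos_divide_le_eq algebra_simps)
    then show "n \<le> k * (m n + 1)" unfolding of_nat_le_iff .
  qed
  have m_large: "\<forall>\<^sub>F n in sequentially. m n \<ge> L" for L
  proof (rule eventually_sequentiallyI)
    fix n assume "k * (L + 1) \<le> n"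
    then have "k * (L + 1) \<le> k * (m n + 1)" using m(3)[of n] by linarith
    then show "L \<le> m n" using assms(1) by simp
  qed
  have c0: "c > 0" using c assms(1,2) by (cases "s = 2") auto

  show "\<forall>\<^sub>F n in sequentially. f n - \<epsilon> * (real n)\<^sup>2
        \<le> real (RT s n (complete_graph (k * s + r)) (c * real (erdos_rogers s (s + 1) (m n))))"
    if "r \<ge> 1" "\<epsilon> > 0"
  proof -
    \<comment> \<open>The number of parts that a K_s-free set of the join can meet; the hypotheses
      on \<open>c\<close> say exactly that c > d.\<close>
    define d where "d = (if s = 2 then 1 else k)"
    have d: "real d < c" using c assms(2) by (cases "s = 2") (auto simp: d_def)
    \<comment> \<open>The required d(e + 1) < c e is equivalent to e > d/(c - d), which holds once e
      is large.\<close>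
    obtain N where N: "\<And>j. j \<ge> N \<Longrightarrow> erdos_rogers s (s + 1) j \<ge> nat \<lceil>real d / (c - real d)\<rceil> + 1"
      using erdos_rogers_unbounded[OF assms(2)] by blast
    obtain n0 where n0: "\<And>n. n \<ge> n0 \<Longrightarrow> m n \<ge> N"
      using m_large[of N] by (auto simp: eventually_sequentially)
    show ?thesis
    proof (rule eventually_sequentiallyI)
      \<comment> \<open>From n \<ge> 1/\<epsilon> on, the lower-order term n/2 is at most \<epsilon>
        n^2.\<close>
      fix n assume n: "max n0 (nat \<lceil>1 / \<epsilon>\<rceil>) \<le> n"
      define e where "e = erdos_rogers s (s + 1) (m n)"
      have "e \<ge> nat \<lceil>real d / (c - real d)\<rceil> + 1" unfolding e_def using n0 n N by simp
      then have "real d / (c - real d) < real e" by linarith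
      then have "real (d * (e + 1)) < c * real e" using d by (simp add: pos_divide_less_eq algebra_simps)
      then have "f n - real n / 2 \<le> real (RT s n (complete_graph (k * s + r)) (c * real e))"
        unfolding f_def using assms(1,2) that(1) m(3)[of n]
        by (intro RT_lower_bound[where m = "m n"]) (auto simp: e_def d_def)
      moreover have "1 / \<epsilon> \<le> real n" using n by linarith
      then have "1 \<le> \<epsilon> * real n" using that(2) by (simp add: pos_divide_le_eq mult.commute)
      then have "1 * real n \<le> \<epsilon> * real n * real n" by (intro mult_right_mono) auto
      then have "real n / 2 \<le> \<epsilon> * (real n)\<^sup>2" by (simp add: power2_eq_square)
      ultimately show "f n - \<epsilon> * (real n)\<^sup>2 \<le> real (RT s n (complete_graph (k * s + r))
          (c * real (erdos_rogers s (s + 1) (m n))))"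
        unfolding e_def by linarith
    qed
  qed

  show "\<forall>\<^sub>F n in sequentially.
      real (RT s n (complete_graph (k * s + 1)) (c * real (erdos_rogers s (s + 1) (m n))))
        \<le> f n + \<epsilon> * (real n)\<^sup>2" if "\<epsilon> > 0"
  proof -
    define \<eta> where "\<eta> = min \<epsilon> 1"
    have \<eta>: "0 < \<eta>" "\<eta> \<le> 1" "\<eta> \<le> \<epsilon>" using that by (auto simp: \<eta>_def)
    define A where "A = 2 ^ (k * s) * c"
    have A: "A > 0" using c0 by (simp add: A_def)
    \<comment> \<open>Chosen so that A \<delta> \<le> \<eta>^2/2: the s-independence bound then uses
      up only half of the linear term \<eta>^2 n.\<close>
    define \<delta> where "\<delta> = min 1 (\<eta>\<^sup>2 / (2 * A))"
    have \<delta>: "0 < \<delta>" "\<delta> \<le> 1" using \<eta> A by (auto simp: \<delta>_def)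
    have "\<delta> \<le> \<eta>\<^sup>2 / (2 * A)" by (simp add: \<delta>_def)
    then have \<delta>A: "A * \<delta> \<le> \<eta>\<^sup>2 / 2" using A by (simp add: pos_le_divide_eq mult_ac)
    obtain T where T: "\<And>N. N \<ge> 1 \<Longrightarrow> real (erdos_rogers s (s + 1) N) \<le> \<delta> * real N + T"
      using erdos_rogers_sublinear[OF \<delta> assms(2)] by blast
    obtain n0 where n0: "\<And>n. n \<ge> n0 \<Longrightarrow> m n \<ge> 1"
      using m_large[of 1] by (auto simp: eventually_sequentially)
    \<comment> \<open>The solution for n of (\<eta>^2/2)(n + 1) + A T \<le> \<eta>^2 n - 1, taken
      with equality.\<close>
    define B where "B = (\<eta>\<^sup>2 / 2 + A * T + 1) / (\<eta>\<^sup>2 / 2)"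
    show ?thesis
    proof (rule eventually_sequentiallyI)
      fix n assume n: "max n0 (nat \<lceil>B\<rceil>) \<le> n"
      let ?e = "real (erdos_rogers s (s + 1) (m n))"
      have "B \<le> real n" using n by linarith
      then have big: "\<eta>\<^sup>2 / 2 + A * T + 1 \<le> real n * (\<eta>\<^sup>2 / 2)"
        unfolding B_def using \<eta>(1) by (subst (asm) pos_divide_le_eq) auto
      have "real n / real k \<le> real n" using assms(1) div_by_1 divide_left_mono[of 1 "real k" "real n"] by simp
      then have mn: "real (m n) \<le> real n + 1" using m(2)[of n] by linarith
      have "A * ?e \<le> A * (\<delta> * real (m n) + T)"
        using T[of "m n"] n0[of n] n A by (intro mult_left_mono) auto
      also have "\<dots> = A * \<delta> * real (m n) + A * T" by (simp add: algebra_simps)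
      also have "\<dots> \<le> \<eta>\<^sup>2 / 2 * (real n + 1) + A * T"
        using \<delta>A mn by (intro add_right_mono mult_mono) auto
      also have "\<dots> \<le> \<eta>\<^sup>2 * real n - 1" using big by (simp add: field_simps)
      finally have "2 ^ (k * s) * (c * ?e) \<le> \<eta>\<^sup>2 * real n - 1" by (simp add: A_def mult_ac)
      then have "real (RT s n (complete_graph (k * s + 1)) (c * ?e)) \<le> f n + \<eta> * (real n)\<^sup>2"
        unfolding f_def using assms(1,2) \<eta> by (intro RT_upper_bound) auto
      also have "\<dots> \<le> f n + \<epsilon> * (real n)\<^sup>2" using \<eta>(3) by (simp add: mult_right_mono)
      finally show "real (RT s n (complete_graph (k * s + 1)) (c * ?e)) \<le> f n + \<epsilon> * (real n)\<^sup>2" .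
    qed
  qed
qed

theorem theorem7p3:
  fixes k s r :: nat and c :: real and m :: "nat \<Rightarrow> nat"
  assumes "k \<ge> 2" and "s \<ge> 2" and "1 \<le> r" and "r \<le> k - 1"
    and "s = 2 \<Longrightarrow> c > 1"
    and "s \<ge> 3 \<Longrightarrow> c > real k"
    and rounding: "\<And>n. int (m n) = \<lfloor>real n / real k\<rfloor> \<or> int (m n) = \<lceil>real n / real k\<rceil>"
  shows "(\<exists>g \<in> o(\<lambda>n. (real n)\<^sup>2). \<forall>n.
            real (RT s n (complete_graph (k * s + r)) (c * real (erdos_rogers s (s + 1) (m n))))
              \<ge> 1 / 2 * (1 - 1 / real k) * (real n)\<^sup>2 + g n)
       \<and> (r = 1 \<longrightarrow>
          (\<exists>g \<in> o(\<lambda>n. (real n)\<^sup>2). \<forall>n.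
            real (RT s n (complete_graph (k * s + 1)) (c * real (erdos_rogers s (s + 1) (m n))))
              = 1 / 2 * (1 - 1 / real k) * (real n)\<^sup>2 + g n))"
proof -
  define f where "f n = 1 / 2 * (1 - 1 / real k) * (real n)\<^sup>2" for n
  define R where "R j n = real (RT s n (complete_graph (k * s + j))
    (c * real (erdos_rogers s (s + 1) (m n))))" for j n
  note aux = eventually_RT_bounds[OF assms(1,2,5,6) rounding, folded f_def]
  have lower: "\<forall>\<^sub>F n in sequentially. f n - \<epsilon> * (real n)\<^sup>2 \<le> R j n" if "\<epsilon> > 0" "j \<ge> 1" for \<epsilon> j
    using aux(1)[OF _ _ that(2,1)] by (simp add: R_def)
  have upper: "\<forall>\<^sub>F n in sequentially. R 1 n \<le> f n + \<epsilon> * (real n)\<^sup>2" if "\<epsilon> > 0" for \<epsilon>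
    using aux(2)[OF _ _ that] by (simp add: R_def)
  have "\<exists>g \<in> o(\<lambda>n. (real n)\<^sup>2). \<forall>n. R r n \<ge> f n + g n"
  proof (rule bexI)
    \<comment> \<open>Only the deficit below \<open>f\<close> is controlled for general r, so the
      error term is cut off at 0 from above.\<close>
    show "\<forall>n. R r n \<ge> f n + min 0 (R r n - f n)" by auto
    show "(\<lambda>n. min 0 (R r n - f n)) \<in> o(\<lambda>n. (real n)\<^sup>2)"
    proof (rule landau_o.smallI)
      fix \<epsilon> :: real assume e: "\<epsilon> > 0"
      show "\<forall>\<^sub>F n in sequentially. norm (min 0 (R r n - f n)) \<le> \<epsilon> * norm ((real n)\<^sup>2)"
        using lower[OF e assms(3)] by (rule eventually_mono) (use e in \<open>auto simp: min_def\<close>)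
    qed
  qed
  moreover have "\<exists>g \<in> o(\<lambda>n. (real n)\<^sup>2). \<forall>n. R 1 n = f n + g n"
  proof (rule bexI)
    show "\<forall>n. R 1 n = f n + (R 1 n - f n)" by simp
    \<comment> \<open>Now the bounds from both sides are available, so the full difference is the
      error term.\<close>
    show "(\<lambda>n. R 1 n - f n) \<in> o(\<lambda>n. (real n)\<^sup>2)"
    proof (rule landau_o.smallI)
      fix \<epsilon> :: real assume e: "\<epsilon> > 0"
      show "\<forall>\<^sub>F n in sequentially. norm (R 1 n - f n) \<le> \<epsilon> * norm ((real n)\<^sup>2)"
        using lower[OF e order_refl] upper[OF e] by eventually_elim (auto simp: abs_le_iff)
    qed
  qed
  ultimately show ?thesis unfolding R_def f_def by (intro conjI impI)
qed

end
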